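(* Let $K$ be an infinite field with $\mathrm{char}(K)\neq 2$, and let $T_{\mathrm{Ass}}(UJ_2)\subseteq J(X)$ be the set of all $\mathbb{Z}_2$-graded polynomial identities of $UJ_2=UJ_2(K)$ endowed with the associative grading. Let $I$ be the $T_{\mathbb{Z}_2}$-ideal of $J(X)$ generated by the polynomials \[(y_1,y_2,y_3),\quad (z_1,y_1,y_2),\quad (z_1,y_1,z_2),\quad (z_1,z_2,z_3),\quad (z_1z_2,z_3,z_4).\] Then $I=T_{\mathrm{Ass}}(UJ_2)$. Moreover, let $S\subseteq J(X)$ be the set of all polynomials of the forms (a) $Y'Z'$, (b) $(Y'z_{j_1})Z'$, (c) $(((y_iz_{j_1})z_{j_2})Y')Z'$, where $i\geq 1$, $Y'=y_{i_1}\cdots y_{i_r}$ with $r\geq 0$ and $i_1\leq\cdots\leq i_r$, and $Z'=z_{l_1}\cdots z_{l_s}$ with $s\geq 0$ even and $j_1\leq j_2\leq l_1\leq\cdots\leq l_s$ (that is, $l_1\le\cdots\le l_s$ in (a), $j_1\leq l_1\leq\cdots\leq l_s$ in (b), and $j_1\leq j_2\leq l_1\leq\cdots\leq l_s$ in (c)). Then the elements $g+I$, $g\in S$, form a basis of the quotient vector space $J(X)/I$.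
   Context: $UT_2(K)$ is the associative algebra of $2\times 2$ upper triangular matrices over $K$ with usual product $\cdot$, and $UJ_2=UJ_2(K)$ is the same vector space with the Jordan product $u\circ v=\frac12(u\cdot v+v\cdot u)$, written $uv$. A $\mathbb{Z}_2$-grading is a decomposition $UJ_2=(UJ_2)_0\oplus (UJ_2)_1$ with $(UJ_2)_i\circ(UJ_2)_j\subseteq (UJ_2)_{i+j}$. The associative grading is $(UJ_2)_0=\mathrm{span}\{e_{11}+e_{22},e_{12}\}$, $(UJ_2)_1=\mathrm{span}\{e_{11}-e_{22}\}$, where $e_{ij}$ are matrix units. $Y=\{y_1,y_2,\ldots\}$ and $Z=\{z_1,z_2,\ldots\}$ are disjoint infinite sets, $X=Y\cup Z$, and $J(X)$ is the free (unital) Jordan algebra over $K$ freely generated by $X$, with the $\mathbb{Z}_2$-grading in which each $y_i$ is even (degree $0$), each $z_i$ is odd (degree $1$), and the degree of a product of monomials is the sum of the degrees modulo $2$. A $T_{\mathbb{Z}_2}$-ideal is an ideal of $J(X)$ closed under all $\mathbb{Z}_2$-graded endomorphisms of $J(X)$; the $T_{\mathbb{Z}_2}$-ideal generated by a set is the smallest one containing it. An element $f(y_1,\ldots,y_s,z_1,\ldots,z_n)\in J(X)$ is a $\mathbb{Z}_2$-graded polynomial identity of $UJ_2$ if it vanishes under all substitutions of elements of $(UJ_2)_0$ for the $y_i$ and of elements of $(UJ_2)_1$ for the $z_i$. Associator: $(u,v,w)=(uv)w-u(vw)$. Products without parentheses are left-normed: $f_1f_2\cdots f_n=(f_1\cdots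 f_{n-1})f_n$; the empty product is $1$. *)

theory Defs
  imports "HOL-Analysis.Analysis" "HOL-Library.Z2"
begin

section \<open>Unital Jordan algebras\<close>

locale unital_jordan_algebra = vector_space scl
  for scl :: "'k::field \<Rightarrow> 'a::ab_group_add \<Rightarrow> 'a" +
  fixes mul :: "'a \<Rightarrow> 'a \<Rightarrow> 'a" and unit :: 'a
  assumes mul_comm: "mul a b = mul b a"
    and mul_add_left: "mul (a + b) c = mul a c + mul b c"
    and mul_scale_left: "mul (scl r a) b = scl r (mul a b)"
    and unit_left: "mul unit a = a"
    and jordan: "mul (mul (mul a a) b) a = mul (mul a a) (mul b a)"

definition algebra_hom ::
  "('k::field \<Rightarrow> 'a \<Rightarrow> 'a) \<Rightarrow> ('a \<Rightarrow> 'a \<Rightarrow> 'a) \<Rightarrow> 'a \<Rightarrow>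
   ('k \<Rightarrow> 'b \<Rightarrow> 'b) \<Rightarrow> ('b \<Rightarrow> 'b \<Rightarrow> 'b) \<Rightarrow> 'b \<Rightarrow>
   ('a::ab_group_add \<Rightarrow> 'b::ab_group_add) \<Rightarrow> bool"
  where "algebra_hom scl mul unit scl' mul' unit' \<phi> \<longleftrightarrow>
    Vector_Spaces.linear scl scl' \<phi> \<and>
    (\<forall>a b. \<phi> (mul a b) = mul' (\<phi> a) (\<phi> b)) \<and> \<phi> unit = unit'"

section \<open>The free unital Jordan algebra\<close>

text \<open>The free algebra on a set of generators is the algebra of formal terms modulo
  the least congruence that makes it a unital Jordan algebra. The universal property is
  proved below (\<open>eval_hom\<close>, \<open>eval_var\<close>, \<open>eval_unique\<close>).\<close>

datatype ('k, 'x) jterm =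
    TVar 'x | TOne | TZero
  | TAdd "('k, 'x) jterm" "('k, 'x) jterm"
  | TNeg "('k, 'x) jterm"
  | TScale 'k "('k, 'x) jterm"
  | TMul "('k, 'x) jterm" "('k, 'x) jterm"

inductive jeq :: "('k::field, 'x) jterm \<Rightarrow> ('k, 'x) jterm \<Rightarrow> bool" where
  refl: "jeq a a"
| sym: "jeq a b \<Longrightarrow> jeq b a"
| trans: "jeq a b \<Longrightarrow> jeq b c \<Longrightarrow> jeq a c"
| cong_add: "jeq a a' \<Longrightarrow> jeq b b' \<Longrightarrow> jeq (TAdd a b) (TAdd a' b')"
| cong_neg: "jeq a a' \<Longrightarrow> jeq (TNeg a) (TNeg a')"
| cong_scale: "jeq a a' \<Longrightarrow> jeq (TScale r a) (TScale r a')"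
| cong_mul: "jeq a a' \<Longrightarrow> jeq b b' \<Longrightarrow> jeq (TMul a b) (TMul a' b')"
| add_assoc: "jeq (TAdd (TAdd a b) c) (TAdd a (TAdd b c))"
| add_comm: "jeq (TAdd a b) (TAdd b a)"
| add_zero: "jeq (TAdd TZero a) a"
| add_neg: "jeq (TAdd (TNeg a) a) TZero"
| scale_add: "jeq (TScale r (TAdd a b)) (TAdd (TScale r a) (TScale r b))"
| add_scale: "jeq (TScale (r + s) a) (TAdd (TScale r a) (TScale s a))"
| scale_scale: "jeq (TScale r (TScale s a)) (TScale (r * s) a)"
| scale_one: "jeq (TScale 1 a) a"
| mul_comm: "jeq (TMul a b) (TMul b a)"
| mul_add: "jeq (TMul (TAdd a b) c) (TAdd (TMul a c) (TMul b c))"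
| mul_scale: "jeq (TMul (TScale r a) b) (TScale r (TMul a b))"
| mul_one: "jeq (TMul TOne a) a"
| jordan: "jeq (TMul (TMul (TMul a a) b) a) (TMul (TMul a a) (TMul b a))"

quotient_type (overloaded) ('k, 'x) free_jordan = "('k::field, 'x) jterm" / jeq
  by (intro equivpI reflpI sympI transpI) (blast intro: jeq.intros)+

lift_definition var :: "'x \<Rightarrow> ('k::field, 'x) free_jordan" is TVar .

lift_definition scaleJ :: "'k::field \<Rightarrow> ('k, 'x) free_jordan \<Rightarrow> ('k, 'x) free_jordan"
  is TScale by (rule jeq.cong_scale)

instantiation free_jordan :: (field, type) "{ab_group_add, times, one}"
begin

lift_definition zero_free_jordan :: "('a, 'b) free_jordan" is TZero .
lift_definition one_free_jordan :: "('a, 'b) free_jordan" is TOne .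
lift_definition plus_free_jordan ::
  "('a, 'b) free_jordan \<Rightarrow> ('a, 'b) free_jordan \<Rightarrow> ('a, 'b) free_jordan"
  is TAdd by (rule jeq.cong_add)
lift_definition uminus_free_jordan :: "('a, 'b) free_jordan \<Rightarrow> ('a, 'b) free_jordan"
  is TNeg by (rule jeq.cong_neg)
lift_definition times_free_jordan ::
  "('a, 'b) free_jordan \<Rightarrow> ('a, 'b) free_jordan \<Rightarrow> ('a, 'b) free_jordan"
  is TMul by (rule jeq.cong_mul)
definition minus_free_jordan ::
  "('a, 'b) free_jordan \<Rightarrow> ('a, 'b) free_jordan \<Rightarrow> ('a, 'b) free_jordan"
  where "minus_free_jordan a b = a + - b"

instance
proof
  fix a b c :: "('a, 'b) free_jordan"
  show "a + b + c = a + (b + c)" by transfer (rule jeq.add_assoc)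
  show "a + b = b + a" by transfer (rule jeq.add_comm)
  show "0 + a = a" by transfer (rule jeq.add_zero)
  show "- a + a = 0" by transfer (rule jeq.add_neg)
  show "a - b = a + - b" by (rule minus_free_jordan_def)
qed

end

interpretation J: unital_jordan_algebra scaleJ
  "(*) :: ('k::field, 'x) free_jordan \<Rightarrow> _ \<Rightarrow> _" 1
proof
  fix r s :: 'k and a b c :: "('k, 'x) free_jordan"
  show "scaleJ r (a + b) = scaleJ r a + scaleJ r b" by transfer (rule jeq.scale_add)
  show "scaleJ (r + s) a = scaleJ r a + scaleJ s a" by transfer (rule jeq.add_scale)
  show "scaleJ r (scaleJ s a) = scaleJ (r * s) a" by transfer (rule jeq.scale_scale)
  show "scaleJ 1 a = a" by transfer (rule jeq.scale_one)
  show "a * b = b * a" by transfer (rule jeq.mul_comm)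
  show "(a + b) * c = a * c + b * c" by transfer (rule jeq.mul_add)
  show "scaleJ r a * b = scaleJ r (a * b)" by transfer (rule jeq.mul_scale)
  show "1 * a = a" by transfer (rule jeq.mul_one)
  show "a * a * b * a = a * a * (b * a)" by transfer (rule jeq.jordan)
qed

lemma free_jordan_induct [case_names var one zero add neg scale mul]:
  fixes f :: "('k::field, 'x) free_jordan"
  assumes "\<And>x. P (var x)" "P 1" "P 0"
    and "\<And>a b. P a \<Longrightarrow> P b \<Longrightarrow> P (a + b)"
    and "\<And>a. P a \<Longrightarrow> P (- a)"
    and "\<And>r a. P a \<Longrightarrow> P (scaleJ r a)"
    and "\<And>a b. P a \<Longrightarrow> P b \<Longrightarrow> P (a * b)"
  shows "P f"
proof -
  have "P (abs_free_jordan t)" for t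
    by (induction t)
      (use assms in \<open>simp_all add: var.abs_eq[symmetric] one_free_jordan.abs_eq[symmetric]
        zero_free_jordan.abs_eq[symmetric] plus_free_jordan.abs_eq[symmetric]
        uminus_free_jordan.abs_eq[symmetric] scaleJ.abs_eq[symmetric]
        times_free_jordan.abs_eq[symmetric]\<close>)
  then show ?thesis by (metis Quotient_free_jordan Quotient_def)
qed

section \<open>Evaluation of Jordan polynomials\<close>

primrec teval ::
  "('k \<Rightarrow> 'a \<Rightarrow> 'a) \<Rightarrow> ('a \<Rightarrow> 'a \<Rightarrow> 'a) \<Rightarrow> 'a \<Rightarrow> ('x \<Rightarrow> 'a) \<Rightarrow>
   ('k, 'x) jterm \<Rightarrow> 'a::ab_group_add"
  where
  "teval scl mul unit \<rho> (TVar x) = \<rho> x"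
| "teval scl mul unit \<rho> TOne = unit"
| "teval scl mul unit \<rho> TZero = 0"
| "teval scl mul unit \<rho> (TAdd a b) = teval scl mul unit \<rho> a + teval scl mul unit \<rho> b"
| "teval scl mul unit \<rho> (TNeg a) = - teval scl mul unit \<rho> a"
| "teval scl mul unit \<rho> (TScale r a) = scl r (teval scl mul unit \<rho> a)"
| "teval scl mul unit \<rho> (TMul a b) = mul (teval scl mul unit \<rho> a) (teval scl mul unit \<rho> b)"

text \<open>The value is independent of the chosen representative as soon as the target is a
  unital Jordan algebra.\<close>

definition eval ::
  "('k::field \<Rightarrow> 'a \<Rightarrow> 'a) \<Rightarrow> ('a \<Rightarrow> 'a \<Rightarrow> 'a) \<Rightarrow> 'a \<Rightarrow> ('x \<Rightarrow> 'a) \<Rightarrow>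
   ('k, 'x) free_jordan \<Rightarrow> 'a::ab_group_add"
  where "eval scl mul unit \<rho> f = teval scl mul unit \<rho> (rep_free_jordan f)"

context unital_jordan_algebra
begin

lemma teval_cong:
  assumes "jeq s t"
  shows "teval scl mul unit \<rho> s = teval scl mul unit \<rho> t"
proof -
  note comm = mul_comm and jord = jordan
  show ?thesis
    using assms
  proof (induction rule: jeq.induct)
    case (mul_comm a b)
    then show ?case by (simp add: comm)
  next
    case (jordan a b)
    then show ?case by (simp add: jord)
  next
    case (add_comm a b)
    then show ?case by (simp add: add.commute)
  qed (simp_all add: scale_right_distrib scale_left_distrib mul_add_left mul_scale_left
      unit_left add.assoc)
qed

lemma eval_abs: "eval scl mul unit \<rho> (abs_free_jordan t) = teval scl mul unit \<rho> t"
  unfolding eval_def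
  by (rule teval_cong) (metis Quotient_free_jordan Quotient_rep_abs jeq.refl)

lemma eval_var: "eval scl mul unit \<rho> (var x) = \<rho> x"
  by (simp add: var.abs_eq eval_abs)

lemma abs_surj: "\<exists>t. f = abs_free_jordan t"
  by (metis Quotient_free_jordan Quotient_def)

lemma eval_hom:
  fixes \<rho> :: "'x \<Rightarrow> 'a"
  shows "algebra_hom scaleJ (*) 1 scl mul unit (eval scl mul unit \<rho>)"
proof -
  have add: "eval scl mul unit \<rho> (a + b) = eval scl mul unit \<rho> a + eval scl mul unit \<rho> b"
    for a b :: "('k, 'x) free_jordan"
    using abs_surj[of a] abs_surj[of b] by (auto simp: plus_free_jordan.abs_eq eval_abs)
  have sc: "eval scl mul unit \<rho> (scaleJ r a) = scl r (eval scl mul unit \<rho> a)"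
    for r and a :: "('k, 'x) free_jordan"
    using abs_surj[of a] by (auto simp: scaleJ.abs_eq eval_abs)
  have ml: "eval scl mul unit \<rho> (a * b) = mul (eval scl mul unit \<rho> a) (eval scl mul unit \<rho> b)"
    for a b :: "('k, 'x) free_jordan"
    using abs_surj[of a] abs_surj[of b] by (auto simp: times_free_jordan.abs_eq eval_abs)
  have "eval scl mul unit \<rho> 1 = unit"
    by (simp add: one_free_jordan.abs_eq eval_abs)
  moreover have "Vector_Spaces.linear scaleJ scl (eval scl mul unit \<rho>)"
    by (intro Vector_Spaces.linear_iff[THEN iffD2] conjI allI
        J.vector_space_axioms vector_space_axioms add sc)
  ultimately show ?thesis by (simp add: algebra_hom_def ml)
qed

lemma eval_unique:
  assumes "algebra_hom scaleJ (*) 1 scl mul unit \<phi>" and "\<And>x. \<phi> (var x) = \<rho> x"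
  shows "\<phi> = eval scl mul unit \<rho>"
proof
  fix f
  have E: "algebra_hom scaleJ (*) 1 scl mul unit (eval scl mul unit \<rho>)"
    by (rule eval_hom)
  interpret p: Vector_Spaces.linear scaleJ scl \<phi>
    using assms(1) by (simp add: algebra_hom_def)
  interpret e: Vector_Spaces.linear scaleJ scl "eval scl mul unit \<rho>"
    using E by (simp add: algebra_hom_def)
  show "\<phi> f = eval scl mul unit \<rho> f"
    by (induction f rule: free_jordan_induct)
      (use assms E in \<open>simp_all add: algebra_hom_def eval_var p.add e.add p.scale e.scale
        p.neg e.neg p.zero e.zero\<close>)
qed

end

section \<open>Graded variables, graded endomorphisms and T-ideals\<close>

text \<open>Variables are indexed from 0 instead of 1. Degrees in the group of order two are
  elements of the type \<open>bit\<close>.\<close>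

datatype gvar = Y nat | Z nat

type_synonym 'k jpoly = "('k, gvar) free_jordan"

abbreviation y :: "nat \<Rightarrow> 'k::field jpoly" where "y i \<equiv> var (Y i)"
abbreviation z :: "nat \<Rightarrow> 'k::field jpoly" where "z i \<equiv> var (Z i)"

inductive monomial_of_degree :: "bit \<Rightarrow> 'k::field jpoly \<Rightarrow> bool" where
  "monomial_of_degree 0 1"
| "monomial_of_degree 0 (y i)"
| "monomial_of_degree 1 (z i)"
| "monomial_of_degree d u \<Longrightarrow> monomial_of_degree e v \<Longrightarrow> monomial_of_degree (d + e) (u * v)"

definition J_component :: "bit \<Rightarrow> 'k::field jpoly set" where
  "J_component d = J.span {u. monomial_of_degree d u}"

definition graded_endomorphism :: "('k::field jpoly \<Rightarrow> 'k jpoly) \<Rightarrow> bool" where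
  "graded_endomorphism \<phi> \<longleftrightarrow>
    algebra_hom scaleJ (*) 1 scaleJ (*) 1 \<phi> \<and> (\<forall>d. \<phi> ` J_component d \<subseteq> J_component d)"

definition T_ideal :: "'k::field jpoly set \<Rightarrow> bool" where
  "T_ideal I \<longleftrightarrow> J.subspace I \<and> (\<forall>f\<in>I. \<forall>g. f * g \<in> I \<and> g * f \<in> I) \<and>
    (\<forall>\<phi>. graded_endomorphism \<phi> \<longrightarrow> \<phi> ` I \<subseteq> I)"

definition T_ideal_generated :: "'k::field jpoly set \<Rightarrow> 'k jpoly set" where
  "T_ideal_generated G = \<Inter>{I. T_ideal I \<and> G \<subseteq> I}"

lemma T_ideal_T_ideal_generated: "T_ideal (T_ideal_generated G)"
  unfolding T_ideal_generated_def T_ideal_def J.subspace_def by blast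

lemma T_ideal_generated_superset: "G \<subseteq> T_ideal_generated G"
  unfolding T_ideal_generated_def by blast

lemma T_ideal_generated_least: "T_ideal I \<Longrightarrow> G \<subseteq> I \<Longrightarrow> T_ideal_generated G \<subseteq> I"
  unfolding T_ideal_generated_def by blast

section \<open>The algebra of upper triangular matrices with the associative grading\<close>

text \<open>The instances of \<open>times\<close> and \<open>one\<close> for vectors are componentwise, so the matrix
  product \<open>**\<close> and the identity matrix \<open>mat 1\<close> are used throughout.\<close>

definition scaleM :: "'k::field \<Rightarrow> 'k^2^2 \<Rightarrow> 'k^2^2" where
  "scaleM r A = (\<chi> i j. r * A $ i $ j)"

interpretation M: vector_space "scaleM :: 'k::field \<Rightarrow> 'k^2^2 \<Rightarrow> 'k^2^2"
  by unfold_locales (simp_all add: scaleM_def vec_eq_iff algebra_simps)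

definition matrix_unit :: "2 \<Rightarrow> 2 \<Rightarrow> 'k::field^2^2" where
  "matrix_unit p q = (\<chi> i j. if i = p \<and> j = q then 1 else 0)"

definition jordan_prod :: "'k::field^2^2 \<Rightarrow> 'k^2^2 \<Rightarrow> 'k^2^2" where
  "jordan_prod u v = scaleM (1 / 2) (u ** v + v ** u)"

definition UJ2 :: "('k::field^2^2) set" where
  "UJ2 = {A. A $ 2 $ 1 = 0}"

definition UJ2_ass :: "bit \<Rightarrow> ('k::field^2^2) set" where
  "UJ2_ass d = (if d = 0
     then M.span {matrix_unit 1 1 + matrix_unit 2 2, matrix_unit 1 2}
     else M.span {matrix_unit 1 1 - matrix_unit 2 2})"

lemma two_neq_0:
  assumes "CHAR('k::field) \<noteq> 2"
  shows "(2::'k) \<noteq> 0"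
proof
  assume "(2::'k) = 0"
  then have "CHAR('k) dvd 2"
    by (metis of_nat_eq_0_iff_char_dvd of_nat_numeral)
  then have "CHAR('k) = 1 \<or> CHAR('k) = 2"
    using prime_nat_iff[of 2] two_is_prime_nat by blast
  then show False using assms by simp
qed

lemma add_mult_right: "(A + B) ** C = A ** C + B ** (C :: 'k::field^2^2)"
  by (simp add: vec_eq_iff matrix_matrix_mult_def sum_2 algebra_simps)

lemma scaleM_mult_left: "scaleM r A ** B = scaleM r (A ** B)"
  and scaleM_mult_right: "A ** scaleM r B = scaleM r (A ** B)"
  by (simp_all add: scaleM_def vec_eq_iff matrix_matrix_mult_def sum_2 algebra_simps)

lemma jordan_prod_algebra:
  assumes "CHAR('k::field) \<noteq> 2"
  shows "unital_jordan_algebra (scaleM :: 'k \<Rightarrow> 'k^2^2 \<Rightarrow> 'k^2^2) jordan_prod (mat 1)"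
proof -
  have two: "(2::'k) \<noteq> 0"
    using assms by (rule two_neq_0)
  obtain h where h: "jordan_prod = (\<lambda>u v :: 'k^2^2. scaleM h (u ** v + v ** u))"
    by (rule that[of "1 / 2"]) (intro ext jordan_prod_def)
  show ?thesis
  proof
    fix r :: 'k and a b c :: "'k^2^2"
    show "jordan_prod a b = jordan_prod b a"
      by (simp add: jordan_prod_def add.commute)
    show "jordan_prod (a + b) c = jordan_prod a c + jordan_prod b c"
      by (simp add: jordan_prod_def scaleM_def vec_eq_iff matrix_matrix_mult_def sum_2 algebra_simps)
    show "jordan_prod (scaleM r a) b = scaleM r (jordan_prod a b)"
      by (simp add: jordan_prod_def scaleM_def vec_eq_iff matrix_matrix_mult_def sum_2 algebra_simps)
    show "jordan_prod (mat 1) a = a"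
      using two by (simp add: jordan_prod_def scaleM_def vec_eq_iff)
    show "jordan_prod (jordan_prod (jordan_prod a a) b) a =
      jordan_prod (jordan_prod a a) (jordan_prod b a)"
      by (simp only: h scaleM_mult_left scaleM_mult_right M.scale_right_distrib
          matrix_add_ldistrib add_mult_right matrix_mul_assoc M.scale_scale mult.assoc add_ac)
  qed
qed

lemma UJ2_ass_0: "A \<in> UJ2_ass 0 \<longleftrightarrow> A $ 2 $ 1 = 0 \<and> A $ 1 $ 1 = A $ 2 $ 2"
  by (auto simp: UJ2_ass_def M.span_insert M.span_singleton scaleM_def matrix_unit_def vec_eq_iff
      forall_2)

lemma UJ2_ass_1:
  "A \<in> UJ2_ass 1 \<longleftrightarrow> A $ 1 $ 2 = 0 \<and> A $ 2 $ 1 = 0 \<and> A $ 2 $ 2 = - A $ 1 $ 1"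
  by (auto simp: UJ2_ass_def M.span_singleton scaleM_def matrix_unit_def vec_eq_iff forall_2)

lemma UJ2_ass_graded:
  assumes "u \<in> UJ2_ass d" "v \<in> UJ2_ass e"
  shows "jordan_prod u v \<in> UJ2_ass (d + e)"
  using assms
  by (cases d; cases e)
    (simp_all add: UJ2_ass_0 UJ2_ass_1 jordan_prod_def scaleM_def matrix_matrix_mult_def sum_2)

lemma UJ2_ass_direct_sum:
  assumes "CHAR('k::field) \<noteq> 2"
  shows "(UJ2 :: ('k^2^2) set) = {u + v | u v. u \<in> UJ2_ass 0 \<and> v \<in> UJ2_ass 1}"
    and "UJ2_ass 0 \<inter> UJ2_ass 1 = {0 :: 'k^2^2}"
proof -
  have two: "(2::'k) \<noteq> 0"
    using assms by (rule two_neq_0)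
  show "UJ2_ass 0 \<inter> UJ2_ass 1 = {0 :: 'k^2^2}"
    using two by (auto simp: UJ2_ass_0 UJ2_ass_1 vec_eq_iff forall_2 eq_neg_iff_add_eq_0
        mult_2[symmetric])
  show "UJ2 = {u + v | u v. u \<in> UJ2_ass 0 \<and> v \<in> (UJ2_ass 1 :: ('k^2^2) set)}" (is "_ = ?R")
  proof
    show "?R \<subseteq> UJ2" by (auto simp: UJ2_def UJ2_ass_0 UJ2_ass_1)
    show "UJ2 \<subseteq> ?R"
    proof
      fix A :: "'k^2^2" assume A: "A \<in> UJ2"
      define h where "h = (A $ 1 $ 1 - A $ 2 $ 2) / 2"
      define v :: "'k^2^2" where "v = scaleM h (matrix_unit 1 1 - matrix_unit 2 2)"
      have "v \<in> UJ2_ass 1" by (simp add: v_def UJ2_ass_1 scaleM_def matrix_unit_def)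
      moreover have "A - v \<in> UJ2_ass 0"
        using A two by (simp add: UJ2_def v_def h_def UJ2_ass_0 scaleM_def matrix_unit_def field_simps)
      ultimately show "A \<in> ?R" by (metis (mono_tags, lifting) diff_add_cancel mem_Collect_eq)
    qed
  qed
qed

lemma UJ2_closed: "u \<in> UJ2 \<Longrightarrow> v \<in> UJ2 \<Longrightarrow> jordan_prod u v \<in> UJ2"
  by (simp add: UJ2_def jordan_prod_def scaleM_def matrix_matrix_mult_def sum_2)

text \<open>Evaluation takes place in the Jordan algebra of all 2 by 2 matrices, of which
  \<open>UJ2\<close> is a unital subalgebra; the values substituted for the variables lie in \<open>UJ2\<close>.\<close>

definition T_Ass :: "'k::field jpoly set" where
  "T_Ass = {f. \<forall>\<rho>. (\<forall>i. \<rho> (Y i) \<in> UJ2_ass 0) \<and> (\<forall>i. \<rho> (Z i) \<in> UJ2_ass 1) \<longrightarrow>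
     eval scaleM jordan_prod (mat 1) \<rho> f = 0}"

section \<open>The ideal, the quotient and the spanning polynomials\<close>

definition associator :: "'a::{times, minus} \<Rightarrow> 'a \<Rightarrow> 'a \<Rightarrow> 'a" where
  "associator u v w = (u * v) * w - u * (v * w)"

definition I_Ass :: "'k::field jpoly set" where
  "I_Ass = T_ideal_generated
    {associator (y 1) (y 2) (y 3), associator (z 1) (y 1) (y 2), associator (z 1) (y 1) (z 2),
     associator (z 1) (z 2) (z 3), associator (z 1 * z 2) (z 3) (z 4)}"

lemma subspace_I_Ass: "J.subspace I_Ass"
  using T_ideal_T_ideal_generated unfolding I_Ass_def T_ideal_def by blast

lifting_forget free_jordan.lifting

quotient_type (overloaded) 'k J_mod_I = "'k::field jpoly" / "\<lambda>f g. f - g \<in> I_Ass"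
proof (intro equivpI reflpI sympI transpI)
  fix f g h :: "'k jpoly"
  show "f - f \<in> I_Ass" using J.subspace_0[OF subspace_I_Ass] by simp
  show "g - f \<in> I_Ass" if "f - g \<in> I_Ass"
    using J.subspace_neg[OF subspace_I_Ass that] by simp
  show "f - h \<in> I_Ass" if "f - g \<in> I_Ass" "g - h \<in> I_Ass"
    using J.subspace_add[OF subspace_I_Ass that] by simp
qed

lift_definition coset :: "'k::field jpoly \<Rightarrow> 'k J_mod_I" is "\<lambda>f. f" .

instantiation J_mod_I :: (field) ab_group_add
begin

lift_definition zero_J_mod_I :: "'a J_mod_I" is 0 .
lift_definition plus_J_mod_I :: "'a J_mod_I \<Rightarrow> 'a J_mod_I \<Rightarrow> 'a J_mod_I" is "(+)"
  using J.subspace_add[OF subspace_I_Ass] by (metis (no_types) add_diff_add)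
lift_definition uminus_J_mod_I :: "'a J_mod_I \<Rightarrow> 'a J_mod_I" is uminus
  using J.subspace_neg[OF subspace_I_Ass] by (metis (no_types) minus_diff_minus)
lift_definition minus_J_mod_I :: "'a J_mod_I \<Rightarrow> 'a J_mod_I \<Rightarrow> 'a J_mod_I" is "(-)"
proof -
  fix f f' g g' :: "'a jpoly"
  assume "f - f' \<in> I_Ass" "g - g' \<in> I_Ass"
  then have "(f - f') - (g - g') \<in> I_Ass" by (rule J.subspace_diff[OF subspace_I_Ass])
  then show "f - g - (f' - g') \<in> I_Ass" by (simp add: algebra_simps)
qed

instance
  by standard (transfer, simp add: J.subspace_0[OF subspace_I_Ass] algebra_simps)+

end

lift_definition scaleQ :: "'k::field \<Rightarrow> 'k J_mod_I \<Rightarrow> 'k J_mod_I" is scaleJ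
  using J.subspace_scale[OF subspace_I_Ass] by (simp add: J.scale_right_diff_distrib[symmetric])

interpretation Q: vector_space "scaleQ :: 'k::field \<Rightarrow> 'k J_mod_I \<Rightarrow> 'k J_mod_I"
  by unfold_locales
    (transfer, simp add: J.subspace_0[OF subspace_I_Ass] J.scale_right_distrib
      J.scale_left_distrib)+

lemma coset_linear: "Vector_Spaces.linear scaleJ scaleQ coset"
  by (intro Vector_Spaces.linear_iff[THEN iffD2] conjI allI
      J.vector_space_axioms Q.vector_space_axioms)
    (transfer, simp add: J.subspace_0[OF subspace_I_Ass])+

lemma coset_surj: "surj coset"
proof (rule surjI)
  show "coset (rep_J_mod_I q) = q" for q
    by (simp add: coset.abs_eq Quotient_abs_rep[OF Quotient_J_mod_I])
qed

lemma coset_eq_iff: "coset f = coset g \<longleftrightarrow> f - g \<in> I_Ass"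
  by transfer simp

text \<open>Left-normed products; by \<open>1 * a = a\<close> the initial factor is harmless.\<close>

definition left_normed :: "'a::{times, one} list \<Rightarrow> 'a" where
  "left_normed fs = foldl (*) 1 fs"

abbreviation y_prod :: "nat list \<Rightarrow> 'k::field jpoly" where
  "y_prod ks \<equiv> left_normed (map y ks)"
abbreviation z_prod :: "nat list \<Rightarrow> 'k::field jpoly" where
  "z_prod ls \<equiv> left_normed (map z ls)"

definition S_Ass :: "'k::field jpoly set" where
  "S_Ass =
    {y_prod ks * z_prod ls | ks ls. sorted ks \<and> even (length ls) \<and> sorted ls} \<union>
    {(y_prod ks * z j1) * z_prod ls | ks j1 ls.
       sorted ks \<and> even (length ls) \<and> sorted (j1 # ls)} \<union>
    {(((y i * z j1) * z j2) * y_prod ks) * z_prod ls | i j1 j2 ks ls.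
       sorted ks \<and> even (length ls) \<and> sorted (j1 # j2 # ls)}"

end

theory Submission
  imports Defs
begin

text \<open>
  Modulo \<open>I\<close> the even part is associative and commutative, the odd part is a module over it,
  and \<open>(e u) v\<close> is symmetric in odd \<open>u\<close>, \<open>v\<close>. The linearized Jordan identity adds
  \<open>((a b) u) v = ((a u) v) b + ((b u) v) a - (a b) (u v)\<close> for even \<open>a\<close>, \<open>b\<close>, which reduces
  \<open>(e u) v\<close> to the case of a single variable \<open>e = y\<^sub>i\<close>. Hence the span \<open>P\<close> of the forms (a), (c)
  and the span \<open>Q\<close> of the forms (b) satisfy \<open>P P \<subseteq> P\<close>, \<open>P Q \<subseteq> Q\<close>, \<open>Q Q \<subseteq> P\<close>, and \<open>P + Q\<close> is everything.

  For independence, substitute \<open>y\<^sub>i = \<alpha>\<^sub>i + \<beta>\<^sub>i e\<^sub>1\<^sub>2\<close> and \<open>z\<^sub>i = \<gamma>\<^sub>i (e\<^sub>1\<^sub>1 - e\<^sub>2\<^sub>2)\<close>. Only the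
  forms (b) have an \<open>e\<^sub>1\<^sub>1 - e\<^sub>2\<^sub>2\<close> component, and it is a monomial determining the form. For the forms (a) the \<open>e\<^sub>1\<^sub>2\<close>
  component is the derivative, along \<open>\<beta>\<close>, of the scalar one; for (c) one term carrying \<open>\<beta>\<^sub>i\<close> of that
  derivative is missing. So in a vanishing combination the missing terms cancel among themselves, and
  they are different monomials. Monomial functions on an infinite field are independent because they
  are distinct characters. Since \<open>I \<subseteq> T\<close>, spanning modulo \<open>I\<close> and independence modulo \<open>T\<close> give
  \<open>I = T\<close>.
\<close>

section \<open>Jordan algebras satisfying the identities\<close>

text \<open>Commuting right actions may be performed in any order. The sorting of indices in all
  three forms rests on this.\<close>

lemma foldl_permuted_eq:
  assumes "\<And>u a b. f (f u a) b = f (f u b) a" and "mset xs = mset ys"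
  shows "foldl f u xs = foldl f u ys"
proof -
  have "fold (\<lambda>x u. f u x) xs = fold (\<lambda>x u. f u x) ys"
    by (rule fold_multiset_equiv) (use assms in \<open>auto simp: fun_eq_iff\<close>)
  then show ?thesis by (simp add: foldl_conv_fold)
qed

text \<open>Even products of odd variables grow by pairs \<open>z a \<cdot> z b\<close> at the right
  end, so the induction peels off two entries there.\<close>

lemma even_length_induct [consumes 1, case_names Nil snoc2]:
  assumes "even (length xs)" and "P []"
    and "\<And>xs a b. even (length xs) \<Longrightarrow> P xs \<Longrightarrow> P (xs @ [a, b])"
  shows "P xs"
  using assms(1)
proof (induction xs rule: length_induct)
  case (1 xs)
  show ?case
  proof (cases xs rule: rev_cases)
    case (snoc xs' b)
    with 1 obtain xs'' a where "xs' = xs'' @ [a]" by (cases xs' rule: rev_cases) auto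
    with snoc 1 assms(3)[of xs'' a b] show ?thesis by simp
  qed (simp add: assms(2))
qed

context unital_jordan_algebra
begin

lemma unit_right: "mul a unit = a"
  using unit_left mul_comm by metis

lemma mul_add_right: "mul c (a + b) = mul c a + mul c b"
  using mul_add_left mul_comm by metis

lemma mul_scale_right: "mul b (scl r a) = scl r (mul b a)"
  using mul_scale_left mul_comm by metis

lemma mul_zero_left [simp]: "mul 0 a = 0"
  using mul_add_left[of 0 0 a] by simp

lemma mul_zero_right [simp]: "mul a 0 = 0"
  using mul_zero_left mul_comm by metis

lemma mul_diff_left: "mul (a - b) c = mul a c - mul b c"
  using mul_add_left[of "a - b" b c] by (simp add: algebra_simps)

lemma mul_diff_right: "mul c (a - b) = mul c a - mul c b"
  using mul_diff_left mul_comm by metis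

lemma mul_span:
  assumes "p \<in> span G" and "\<And>g. g \<in> G \<Longrightarrow> mul t g \<in> span H"
  shows "mul t p \<in> span H"
  using assms(1)
proof (induction rule: span_induct_alt)
  case base
  show ?case by (simp add: span_zero)
next
  case (step c x q)
  then show ?case
    by (simp add: mul_add_right mul_scale_right span_add span_scale assms(2))
qed

end

text \<open>An abstract model of the quotient by the ideal. The last five assumptions are the five
  generating identities, stated for arbitrary homogeneous elements, as closure under graded
  substitution provides them.\<close>

locale ass_graded_jordan = unital_jordan_algebra scl mul unit
  for scl :: "'k::field \<Rightarrow> 'a::ab_group_add \<Rightarrow> 'a"
    and mul (infixl "\<cdot>" 70) and unit ("\<one>") +
  fixes Ev Od :: "'a set"
  assumes two_neq_zero: "(2::'k) \<noteq> 0"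
    and subspace_Ev: "subspace Ev" and subspace_Od: "subspace Od"
    and decomp: "\<exists>a\<in>Ev. \<exists>u\<in>Od. x = a + u"
    and unit_Ev [simp]: "\<one> \<in> Ev"
    and Ev_Ev [simp]: "a \<in> Ev \<Longrightarrow> b \<in> Ev \<Longrightarrow> a \<cdot> b \<in> Ev"
    and Ev_Od [simp]: "a \<in> Ev \<Longrightarrow> u \<in> Od \<Longrightarrow> a \<cdot> u \<in> Od"
    and Od_Od [simp]: "u \<in> Od \<Longrightarrow> v \<in> Od \<Longrightarrow> u \<cdot> v \<in> Ev"
    and EEE: "a \<in> Ev \<Longrightarrow> b \<in> Ev \<Longrightarrow> c \<in> Ev \<Longrightarrow> (a \<cdot> b) \<cdot> c = a \<cdot> (b \<cdot> c)"
    and OEE: "u \<in> Od \<Longrightarrow> a \<in> Ev \<Longrightarrow> b \<in> Ev \<Longrightarrow> (u \<cdot> a) \<cdot> b = u \<cdot> (a \<cdot> b)"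
    and OEO: "u \<in> Od \<Longrightarrow> a \<in> Ev \<Longrightarrow> v \<in> Od \<Longrightarrow> (u \<cdot> a) \<cdot> v = u \<cdot> (a \<cdot> v)"
    and OOO: "u \<in> Od \<Longrightarrow> v \<in> Od \<Longrightarrow> w \<in> Od \<Longrightarrow> (u \<cdot> v) \<cdot> w = u \<cdot> (v \<cdot> w)"
    and OO_OO: "u \<in> Od \<Longrightarrow> v \<in> Od \<Longrightarrow> w \<in> Od \<Longrightarrow> x \<in> Od \<Longrightarrow>
      ((u \<cdot> v) \<cdot> w) \<cdot> x = (u \<cdot> v) \<cdot> (w \<cdot> x)"
begin

lemma Od_Ev [simp]: "u \<in> Od \<Longrightarrow> a \<in> Ev \<Longrightarrow> u \<cdot> a \<in> Od"
  using Ev_Od mul_comm by metis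

section \<open>Linearization of the Jordan identity\<close>

lemma no_two_torsion: "x + x = 0 \<Longrightarrow> (x::'a) = 0"
proof -
  assume "x + x = 0"
  then have "scl 2 x = 0"
    using scale_left_distrib[of 1 1 x] by simp
  then show ?thesis using two_neq_zero by simp
qed

text \<open>Polarization of a cubic map in two stages. Only factors 2 are cancelled, so
  characteristic 3 is covered.\<close>

lemma symmetric_trilinear_vanish:
  fixes g :: "'a \<Rightarrow> 'a \<Rightarrow> 'a \<Rightarrow> 'a"
  assumes add1: "\<And>a a' b d. g (a + a') b d = g a b d + g a' b d"
    and add3: "\<And>a b d d'. g a b (d + d') = g a b d + g a b d'"
    and comm: "\<And>a b d. g a b d = g b a d"
    and diag: "\<And>a. g a a a = 0"
  shows "g a b d + g b d a + g d a b = 0"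
proof -
  have add2: "g a (b + b') d = g a b d + g a b' d" for a b b' d
    using add1 comm by metis
  have zero1: "g 0 b d = 0" for b d using add1[of 0 0 b d] by simp
  have zero3: "g a b 0 = 0" for a b using add3[of a b 0 0] by simp
  have neg1: "g (- a) b d = - g a b d" for a b d
    using add1[of a "- a" b d] zero1 by (simp add: eq_neg_iff_add_eq_0 add.commute)
  have neg2: "g b (- a) d = - g b a d" for a b d using neg1 comm by metis
  have neg3: "g b d (- a) = - g b d a" for a b d
    using add3[of b d a "- a"] zero3 by (simp add: eq_neg_iff_add_eq_0 add.commute)
  \<comment> \<open>The diagonal values at \<open>a + x\<close> and \<open>a - x\<close> differ by
    twice their part of odd degree in \<open>x\<close>; the cubic part \<open>g x x x\<close> is
    zero.\<close>
  have partial: "g a a x + (g a x a + g a x a) = 0" (is "?s = 0") for a x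
  proof (rule no_two_torsion)
    have "?s + ?s = g (a + x) (a + x) (a + x) - g (a + - x) (a + - x) (a + - x)"
      by (simp add: add1 add2 add3 neg1 neg2 neg3 comm[of x a] diag[of a] diag[of x]
          del: add_uminus_conv_diff)
    also have "\<dots> = 0" by (simp only: diag diff_self)
    finally show "?s + ?s = 0" .
  qed
  show ?thesis (is "?s = 0")
  proof (rule no_two_torsion)
    have 1: "g (a + b) (a + b) d = g a a d + g b b d + (g a b d + g a b d)"
      by (simp only: add1 add2 comm[of b a] add_ac)
    have 2: "g (a + b) d (a + b) = g a d a + g b d b + (g d a b + g b d a)"
      by (simp only: add1 add3 comm[of a d] add_ac)
    have 3: "g e e d = - (g e d e + g e d e)" for e
      using partial[of e d] by (simp only: eq_neg_iff_add_eq_0)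
    \<comment> \<open>Taking \<open>partial\<close> at \<open>a + b\<close> and removing its
      instances at \<open>a\<close> and \<open>b\<close> leaves the mixed terms, which are twice the
      cyclic sum.\<close>
    show "?s + ?s = 0"
      using partial[of "a + b" d] unfolding 1 2 3[of a] 3[of b] by (simp add: algebra_simps)
  qed
qed

text \<open>With \<open>c\<close> fixed, the Jordan identity says that a map additive in the three
  other arguments vanishes on the diagonal.\<close>

lemma jordan_linearized:
  "((a \<cdot> b) \<cdot> c) \<cdot> d + ((b \<cdot> d) \<cdot> c) \<cdot> a + ((d \<cdot> a) \<cdot> c) \<cdot> b =
   (a \<cdot> b) \<cdot> (c \<cdot> d) + (b \<cdot> d) \<cdot> (c \<cdot> a) + (d \<cdot> a) \<cdot> (c \<cdot> b)"
proof -
  define g where "g a b d = ((a \<cdot> b) \<cdot> c) \<cdot> d - (a \<cdot> b) \<cdot> (c \<cdot> d)" for a b d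
  have "g a b d + g b d a + g d a b = 0"
  proof (rule symmetric_trilinear_vanish[of g])
    show "g (a + a') b d = g a b d + g a' b d" for a a' b d
      by (simp add: g_def mul_add_left)
    show "g a b (d + d') = g a b d + g a b d'" for a b d d'
      by (simp add: g_def mul_add_right)
    show "g a b d = g b a d" for a b d
      unfolding g_def by (simp only: mul_comm)
    show "g a a a = 0" for a
      by (simp add: g_def jordan)
  qed
  then show ?thesis by (simp add: g_def algebra_simps)
qed

section \<open>Commutation rules for even and odd factors\<close>

lemma Ev_left_comm: "a \<in> Ev \<Longrightarrow> b \<in> Ev \<Longrightarrow> c \<in> Ev \<Longrightarrow> a \<cdot> (b \<cdot> c) = b \<cdot> (a \<cdot> c)"
  using EEE mul_comm by metis

lemmas Ev_ac = EEE mul_comm Ev_left_comm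

text \<open>By commutativity this is \<open>OEO\<close> for even \<open>x\<close> and
  \<open>OOO\<close> for odd \<open>x\<close>; additivity gives the rest.\<close>

lemma Od_right_comm:
  assumes "u \<in> Od" "v \<in> Od"
  shows "(x \<cdot> u) \<cdot> v = (x \<cdot> v) \<cdot> u"
proof -
  obtain a w where "a \<in> Ev" "w \<in> Od" "x = a + w" using decomp by metis
  moreover have "(a \<cdot> u) \<cdot> v = (a \<cdot> v) \<cdot> u" if "a \<in> Ev" for a
    using OEO[OF assms(1) that assms(2)] by (simp add: mul_comm)
  moreover have "(w \<cdot> u) \<cdot> v = (w \<cdot> v) \<cdot> u" if "w \<in> Od" for w
    using OOO[OF assms(1) that assms(2)] by (simp add: mul_comm)
  ultimately show ?thesis by (simp add: mul_add_left)
qed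

lemma Ev_right_comm:
  assumes "a \<in> Ev" "b \<in> Ev"
  shows "(x \<cdot> a) \<cdot> b = (x \<cdot> b) \<cdot> a"
proof -
  obtain c w where "c \<in> Ev" "w \<in> Od" "x = c + w" using decomp by metis
  then show ?thesis using assms by (simp add: mul_add_left EEE OEE mul_comm[of a b])
qed

lemma Od_mul_Od:
  assumes "a \<in> Ev" "b \<in> Ev" "u \<in> Od" "v \<in> Od"
  shows "(u \<cdot> a) \<cdot> (v \<cdot> b) = ((a \<cdot> b) \<cdot> u) \<cdot> v"
proof -
  have "(u \<cdot> a) \<cdot> (v \<cdot> b) = u \<cdot> (a \<cdot> (v \<cdot> b))"
    using assms by (simp add: OEO)
  also have "a \<cdot> (v \<cdot> b) = (a \<cdot> b) \<cdot> v"
    using OEE[of v b a] assms by (simp add: mul_comm)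
  also have "u \<cdot> ((a \<cdot> b) \<cdot> v) = ((a \<cdot> b) \<cdot> u) \<cdot> v"
    using OEO[of u "a \<cdot> b" v] assms by (simp add: mul_comm)
  finally show ?thesis .
qed

text \<open>In the linearized Jordan identity for \<open>a\<close>, \<open>b\<close>,
  \<open>v\<close>, \<open>u\<close> the left side of the claim occurs once on the left and twice on
  the right, up to reordering, so one copy survives.\<close>

lemma Ev_product_Od_Od:
  assumes "a \<in> Ev" "b \<in> Ev" "u \<in> Od" "v \<in> Od"
  shows "((a \<cdot> b) \<cdot> u) \<cdot> v =
    ((a \<cdot> u) \<cdot> v) \<cdot> b + ((b \<cdot> u) \<cdot> v) \<cdot> a - (a \<cdot> b) \<cdot> (u \<cdot> v)"
proof -
  have 1: "(b \<cdot> u) \<cdot> (v \<cdot> a) = ((a \<cdot> b) \<cdot> u) \<cdot> v"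
    using Od_mul_Od[of b a u v] assms by (simp add: mul_comm)
  have 2: "(a \<cdot> u) \<cdot> (v \<cdot> b) = ((a \<cdot> b) \<cdot> u) \<cdot> v"
    using Od_mul_Od[of a b u v] assms by (simp add: mul_comm[of u a])
  have 3: "((a \<cdot> b) \<cdot> v) \<cdot> u = ((a \<cdot> b) \<cdot> u) \<cdot> v"
    using Od_right_comm assms by blast
  have "((a \<cdot> b) \<cdot> u) \<cdot> v + ((b \<cdot> u) \<cdot> v) \<cdot> a + ((a \<cdot> u) \<cdot> v) \<cdot> b =
      (a \<cdot> b) \<cdot> (u \<cdot> v) + ((a \<cdot> b) \<cdot> u) \<cdot> v + ((a \<cdot> b) \<cdot> u) \<cdot> v"
    using jordan_linearized[of a b v u] by (simp only: 1 2 3 mul_comm[of u a] mul_comm[of v u])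
  then show ?thesis by (simp add: algebra_simps)
qed

text \<open>For a general even \<open>a\<close> the products \<open>(a \<cdot> u) \<cdot> v\<close> and \<open>a \<cdot> (u \<cdot> v)\<close> differ.\<close>

definition W :: "'a set" where
  "W = {w \<in> Ev. \<forall>u\<in>Od. \<forall>v\<in>Od. (w \<cdot> u) \<cdot> v = w \<cdot> (u \<cdot> v)}"

lemma W_Ev [simp]: "w \<in> W \<Longrightarrow> w \<in> Ev"
  by (simp add: W_def)

lemma W_D: "w \<in> W \<Longrightarrow> u \<in> Od \<Longrightarrow> v \<in> Od \<Longrightarrow> (w \<cdot> u) \<cdot> v = w \<cdot> (u \<cdot> v)"
  by (simp add: W_def del: W_Ev)

lemma unit_W [simp]: "\<one> \<in> W"
  by (simp add: W_def unit_left del: W_Ev)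

lemma Od_Od_W [simp]: "u \<in> Od \<Longrightarrow> v \<in> Od \<Longrightarrow> u \<cdot> v \<in> W"
  by (simp add: W_def OO_OO del: W_Ev)

text \<open>The first factor is a product of odd elements, hence in \<open>W\<close>, so
  \<open>v'\<close> can be split off and the odd factors rearranged. The two even coefficients merge
  into \<open>a \<cdot> b\<close>, to which \<open>Ev_product_Od_Od\<close> applies.\<close>

lemma mul_Od_Od_products:
  assumes "a \<in> Ev" "b \<in> Ev" "u \<in> Od" "u' \<in> Od" "v \<in> Od" "v' \<in> Od"
  shows "((a \<cdot> u) \<cdot> u') \<cdot> ((b \<cdot> v) \<cdot> v') = (((a \<cdot> b) \<cdot> u) \<cdot> v) \<cdot> (u' \<cdot> v')"
proof -
  have "((a \<cdot> u) \<cdot> u') \<cdot> ((b \<cdot> v) \<cdot> v') = (((a \<cdot> u) \<cdot> u') \<cdot> (b \<cdot> v)) \<cdot> v'"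
    using assms by (intro W_D[symmetric]) simp_all
  also have "((a \<cdot> u) \<cdot> u') \<cdot> (b \<cdot> v) = ((a \<cdot> u) \<cdot> (b \<cdot> v)) \<cdot> u'"
    using assms by (intro Od_right_comm) simp_all
  also have "(a \<cdot> u) \<cdot> (b \<cdot> v) = ((a \<cdot> b) \<cdot> u) \<cdot> v"
    using Od_mul_Od[of a b u v] assms by (simp add: mul_comm)
  also have "((((a \<cdot> b) \<cdot> u) \<cdot> v) \<cdot> u') \<cdot> v' = (((a \<cdot> b) \<cdot> u) \<cdot> v) \<cdot> (u' \<cdot> v')"
    using assms by (intro W_D) simp_all
  finally show ?thesis .
qed

end

section \<open>Spanning by the forms (a), (b), (c)\<close>

locale ass_graded_jordan_generators = ass_graded_jordan scl mul unit Ev Od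
  for scl :: "'k::field \<Rightarrow> 'a::ab_group_add \<Rightarrow> 'a"
    and mul (infixl "\<cdot>" 70) and unit ("\<one>") and Ev Od +
  fixes y z :: "nat \<Rightarrow> 'a"
  assumes y_Ev [simp]: "y i \<in> Ev" and z_Od [simp]: "z i \<in> Od"
begin

definition Yp :: "nat list \<Rightarrow> 'a" where
  "Yp ks = foldl (\<cdot>) \<one> (map y ks)"

definition Zp :: "nat list \<Rightarrow> 'a" where
  "Zp ls = foldl (\<cdot>) \<one> (map z ls)"

lemma Yp_simps [simp]: "Yp [] = \<one>" "Yp (ks @ [k]) = Yp ks \<cdot> y k"
  by (simp_all add: Yp_def)

lemma Yp_Ev [simp]: "Yp ks \<in> Ev"
  by (induction ks rule: rev_induct) simp_all

lemma Zp_Nil [simp]: "Zp [] = \<one>"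
  by (simp add: Zp_def)

text \<open>Each further factor flips the parity, so both claims share one induction.\<close>

lemma Zp_W [simp]: "even (length ls) \<Longrightarrow> Zp ls \<in> W"
  and Zp_Od: "odd (length ls) \<Longrightarrow> Zp ls \<in> Od"
  by (induction ls rule: rev_induct) (auto simp: Zp_def unit_left split: if_splits)

lemma Zp_snoc2: "even (length ls) \<Longrightarrow> Zp (ls @ [a, b]) = Zp ls \<cdot> (z a \<cdot> z b)"
  using W_D[OF Zp_W z_Od z_Od, of ls a b] by (simp add: Zp_def)

abbreviation zz :: "'a \<Rightarrow> nat \<Rightarrow> nat \<Rightarrow> 'a" where
  "zz a i j \<equiv> (a \<cdot> z i) \<cdot> z j"

text \<open>The three forms are taken here without any order on the indices, which keeps closure
  under products simple; \<open>forms_sorted\<close> restores the order.\<close>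

definition formsA where
  "formsA = {Yp ks \<cdot> Zp ls | ks ls. even (length ls)}"

definition formsB where
  "formsB = {(Yp ks \<cdot> z j) \<cdot> Zp ls | ks j ls. even (length ls)}"

definition formsC where
  "formsC = {(zz (y i) j1 j2 \<cdot> Yp ks) \<cdot> Zp ls | i j1 j2 ks ls. even (length ls)}"

definition P where "P = span (formsA \<union> formsC)"
definition Q where "Q = span formsB"

lemma formA_P [simp]: "even (length ls) \<Longrightarrow> Yp ks \<cdot> Zp ls \<in> P"
  unfolding P_def by (intro span_base) (auto simp: formsA_def)

lemma formC_P [simp]: "even (length ls) \<Longrightarrow> (zz (y i) j1 j2 \<cdot> Yp ks) \<cdot> Zp ls \<in> P"
  unfolding P_def by (intro span_base) (auto simp: formsC_def)

lemma formB_Q [simp]: "even (length ls) \<Longrightarrow> (Yp ks \<cdot> z j) \<cdot> Zp ls \<in> Q"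
  unfolding Q_def by (intro span_base) (auto simp: formsB_def)

lemma subspace_P: "subspace P" and subspace_Q: "subspace Q"
  by (simp_all add: P_def Q_def)

lemma P_Ev [simp]: "p \<in> P \<Longrightarrow> p \<in> Ev"
proof -
  have "P \<subseteq> Ev"
    unfolding P_def by (rule span_minimal) (auto simp: formsA_def formsC_def subspace_Ev)
  then show "p \<in> P \<Longrightarrow> p \<in> Ev" by blast
qed

lemma mul_P:
  assumes "p \<in> P"
    and "\<And>ks ls. even (length ls) \<Longrightarrow> t \<cdot> (Yp ks \<cdot> Zp ls) \<in> span H"
    and "\<And>i j1 j2 ks ls. even (length ls) \<Longrightarrow> t \<cdot> ((zz (y i) j1 j2 \<cdot> Yp ks) \<cdot> Zp ls) \<in> span H"
  shows "t \<cdot> p \<in> span H"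
  by (rule mul_span[OF assms(1)[unfolded P_def]])
    (auto simp: formsA_def formsC_def intro!: assms(2,3))

section \<open>Closure of \<open>P\<close> and \<open>Q\<close> under multiplication\<close>

lemma unit_P [simp]: "\<one> \<in> P"
  using formA_P[of "[]" "[]"] by (simp add: unit_left)

lemma y_mul_P:
  assumes "p \<in> P"
  shows "y k \<cdot> p \<in> P"
  unfolding P_def
proof (rule mul_P[OF assms], unfold P_def[symmetric])
  fix i j1 j2 ks ls assume ls: "even (length (ls :: nat list))"
  have "y k \<cdot> (Yp ks \<cdot> Zp ls) = Yp (ks @ [k]) \<cdot> Zp ls"
    using ls by (simp add: Ev_ac)
  then show "y k \<cdot> (Yp ks \<cdot> Zp ls) \<in> P" using ls by (simp del: Yp_simps)
  have "y k \<cdot> ((c \<cdot> Yp ks) \<cdot> Zp ls) = (c \<cdot> Yp (ks @ [k])) \<cdot> Zp ls" if "c \<in> Ev" for c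
    using ls that by (simp add: Ev_ac)
  then show "y k \<cdot> ((zz (y i) j1 j2 \<cdot> Yp ks) \<cdot> Zp ls) \<in> P"
    using ls by (simp del: Yp_simps)
qed

lemma z_z_mul_P:
  assumes "p \<in> P"
  shows "(z a \<cdot> z b) \<cdot> p \<in> P"
  unfolding P_def
proof (rule mul_P[OF assms], unfold P_def[symmetric])
  fix i j1 j2 ks ls assume ls: "even (length (ls :: nat list))"
  have *: "(z a \<cdot> z b) \<cdot> (c \<cdot> Zp ls) = c \<cdot> Zp (ls @ [a, b])" if "c \<in> Ev" for c
    using Ev_left_comm[of "z a \<cdot> z b" c "Zp ls"] ls that by (simp add: Zp_snoc2 mul_comm)
  show "(z a \<cdot> z b) \<cdot> (Yp ks \<cdot> Zp ls) \<in> P"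
    using ls by (simp add: *)
  show "(z a \<cdot> z b) \<cdot> ((zz (y i) j1 j2 \<cdot> Yp ks) \<cdot> Zp ls) \<in> P"
    using ls by (simp add: *)
qed

lemma Yp_mul_P: "p \<in> P \<Longrightarrow> Yp ks \<cdot> p \<in> P"
proof (induction ks arbitrary: p rule: rev_induct)
  case (snoc k ks)
  then show ?case using y_mul_P by (simp add: EEE)
qed (simp add: unit_left)

lemma Zp_mul_P: "even (length ls) \<Longrightarrow> p \<in> P \<Longrightarrow> Zp ls \<cdot> p \<in> P"
proof (induction ls arbitrary: p rule: even_length_induct)
  case (snoc2 ls a b)
  then show ?case using z_z_mul_P by (simp add: Zp_snoc2 EEE)
qed (simp add: unit_left)

lemma y_P: "y i \<in> P"
  using y_mul_P[OF unit_P] by (simp add: unit_right)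

lemma z_z_P: "z a \<cdot> z b \<in> P"
  using z_z_mul_P[OF unit_P] by (simp add: unit_right)

lemma zz_y_P: "zz (y i) a b \<in> P"
  using formC_P[of "[]" i a b "[]"] by (simp add: unit_right)

text \<open>The critical case is the product of two cores of form (c): its even coefficients merge
  into \<open>y i \<cdot> y j\<close>, and the linearized Jordan identity reduces this coefficient
  to single variables.\<close>

lemma zz_y_mul_P:
  assumes "p \<in> P"
  shows "zz (y i) a b \<cdot> p \<in> P"
  unfolding P_def
proof (rule mul_P[OF assms], unfold P_def[symmetric])
  let ?c = "zz (y i) a b"
  fix j j1 j2 ks ls assume ls: "even (length (ls :: nat list))"
  have "?c \<cdot> (Yp ks \<cdot> Zp ls) = (?c \<cdot> Yp ks) \<cdot> Zp ls"
    using ls by (simp add: EEE)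
  then show "?c \<cdot> (Yp ks \<cdot> Zp ls) \<in> P" using ls by simp
  let ?d = "zz (y j) j1 j2"
  have "zz (y i \<cdot> y j) a j1 =
      y j \<cdot> zz (y i) a j1 + y i \<cdot> zz (y j) a j1 - y i \<cdot> (y j \<cdot> (z a \<cdot> z j1))"
    using Ev_product_Od_Od[of "y i" "y j" "z a" "z j1"] by (simp add: EEE mul_comm)
  then have "zz (y i \<cdot> y j) a j1 \<in> P"
    by (auto intro!: subspace_add subspace_diff subspace_P y_mul_P zz_y_P z_z_P)
  then have "(z b \<cdot> z j2) \<cdot> zz (y i \<cdot> y j) a j1 \<in> P" by (rule z_z_mul_P)
  then have cd: "?c \<cdot> ?d \<in> P"
    using mul_Od_Od_products[of "y i" "y j" "z a" "z b" "z j1" "z j2"] by (simp add: mul_comm)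
  \<comment> \<open>The even part is commutative and associative, so the two cores can be brought
    together.\<close>
  have "c \<cdot> ((d \<cdot> Yp ks) \<cdot> Zp ls) = Yp ks \<cdot> (Zp ls \<cdot> (c \<cdot> d))"
    if "c \<in> Ev" "d \<in> Ev" for c d
    using ls that by (simp add: Ev_ac)
  then show "?c \<cdot> ((?d \<cdot> Yp ks) \<cdot> Zp ls) \<in> P"
    using ls cd by (simp add: Yp_mul_P Zp_mul_P)
qed

text \<open>A generator of \<open>P\<close> is a product of \<open>Yp ks\<close>,
  \<open>Zp ls\<close> and possibly one core, and multiplication by each of these preserves
  \<open>P\<close>.\<close>

lemma P_mul_P:
  assumes "p \<in> P" "q \<in> P"
  shows "p \<cdot> q \<in> P"
  unfolding P_def
proof (rule mul_P[OF assms(2)], unfold P_def[symmetric])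
  fix j j1 j2 ks ls assume ls: "even (length (ls :: nat list))"
  have "p \<cdot> (Yp ks \<cdot> Zp ls) = Yp ks \<cdot> (Zp ls \<cdot> p)"
    using ls assms(1) by (simp add: Ev_ac)
  then show "p \<cdot> (Yp ks \<cdot> Zp ls) \<in> P"
    using ls assms(1) by (simp add: Yp_mul_P Zp_mul_P)
  have "p \<cdot> ((c \<cdot> Yp ks) \<cdot> Zp ls) = Yp ks \<cdot> (Zp ls \<cdot> (c \<cdot> p))" if "c \<in> Ev" for c
    using ls assms(1) that by (simp add: Ev_ac)
  then show "p \<cdot> ((zz (y j) j1 j2 \<cdot> Yp ks) \<cdot> Zp ls) \<in> P"
    using ls assms(1) by (simp add: Yp_mul_P Zp_mul_P zz_y_mul_P)
qed

text \<open>The elements of \<open>P\<close> that stay in \<open>P\<close> under all pairs of odd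
  variables form a subspace \<open>M\<close>, closed under products by
  \<open>Ev_product_Od_Od\<close>. It contains every factor of the generators.\<close>

lemma zz_P:
  assumes "p \<in> P"
  shows "zz p a b \<in> P"
proof -
  define M where "M = {p \<in> P. \<forall>a b. zz p a b \<in> P}"
  have M_mul: "p \<cdot> q \<in> M" if "p \<in> M" "q \<in> M" for p q
  proof -
    have "zz (p \<cdot> q) a b = zz p a b \<cdot> q + zz q a b \<cdot> p - (p \<cdot> q) \<cdot> (z a \<cdot> z b)" for a b
      using that by (intro Ev_product_Od_Od) (simp_all add: M_def)
    moreover have "zz p a b \<cdot> q + zz q a b \<cdot> p - (p \<cdot> q) \<cdot> (z a \<cdot> z b) \<in> P" for a b
      using that
      by (simp add: M_def P_mul_P z_z_P subspace_add[OF subspace_P] subspace_diff[OF subspace_P])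
    ultimately show ?thesis using that by (simp add: M_def P_mul_P)
  qed
  \<comment> \<open>On \<open>W\<close> two odd factors act as multiplication by the single even
    element \<open>z a \<cdot> z b\<close>, which lies in \<open>P\<close>.\<close>
  have W_M: "w \<in> M" if "w \<in> W" "w \<in> P" for w
    using that by (simp add: M_def W_D P_mul_P z_z_P)
  have "Yp ks \<in> M" for ks
  proof (induction ks rule: rev_induct)
    case (snoc k ks)
    then show ?case using M_mul[of "Yp ks" "y k"] by (simp add: M_def y_P zz_y_P)
  qed (simp add: W_M)
  moreover have "Zp ls \<in> M" if "even (length ls)" for ls
    using W_M[of "Zp ls"] that Zp_mul_P[OF that unit_P] by (simp add: unit_right)
  moreover have "zz (y i) j1 j2 \<in> M" for i j1 j2
    by (rule W_M) (simp_all add: zz_y_P)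
  ultimately have "formsA \<union> formsC \<subseteq> M"
    by (auto simp: formsA_def formsC_def M_mul)
  moreover have "subspace M"
    using subspace_P
    by (auto simp: M_def subspace_def mul_add_left mul_scale_left)
  ultimately have "P \<subseteq> M" unfolding P_def by (rule span_minimal)
  then show ?thesis using assms by (auto simp: M_def)
qed

text \<open>A third odd factor dissolves the core of form (c): \<open>z j1\<close> remains as the
  odd factor, \<open>y i\<close> joins \<open>Yp ks\<close>, and the pair
  \<open>z j2 \<cdot> z j\<close> joins \<open>Zp ls\<close>. Hence form (b) suffices for the odd
  part.\<close>

lemma z_mul_P:
  assumes "p \<in> P"
  shows "z j \<cdot> p \<in> Q"
  unfolding Q_def
proof (rule mul_P[OF assms], unfold Q_def[symmetric])
  fix i j1 j2 ks ls assume ls: "even (length (ls :: nat list))"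
  have A: "z j \<cdot> (Yp ks \<cdot> Zp ls) \<in> Q" if "even (length (ls :: nat list))" for j ks ls
  proof -
    have "z j \<cdot> (Yp ks \<cdot> Zp ls) = (Yp ks \<cdot> z j) \<cdot> Zp ls"
      using OEE[of "z j" "Yp ks" "Zp ls"] that by (simp add: mul_comm)
    then show ?thesis using that by simp
  qed
  then show "z j \<cdot> (Yp ks \<cdot> Zp ls) \<in> Q" using ls .
  have "z j \<cdot> zz (y i) j1 j2 = (y i \<cdot> z j1) \<cdot> (z j2 \<cdot> z j)"
    using OOO[of "y i \<cdot> z j1" "z j2" "z j"] by (simp add: mul_comm)
  also have "\<dots> = z j1 \<cdot> (y i \<cdot> (z j2 \<cdot> z j))"
    using OEE[of "z j1" "y i" "z j2 \<cdot> z j"] by (simp add: mul_comm)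
  finally have 1: "z j \<cdot> zz (y i) j1 j2 = z j1 \<cdot> (y i \<cdot> (z j2 \<cdot> z j))" .
  have "z j \<cdot> ((zz (y i) j1 j2 \<cdot> Yp ks) \<cdot> Zp ls) = (z j \<cdot> zz (y i) j1 j2) \<cdot> (Yp ks \<cdot> Zp ls)"
    using ls by (simp add: OEE EEE)
  also have "\<dots> = z j1 \<cdot> ((y i \<cdot> (z j2 \<cdot> z j)) \<cdot> (Yp ks \<cdot> Zp ls))"
    unfolding 1 using ls by (intro OEE) simp_all
  also have "(y i \<cdot> (z j2 \<cdot> z j)) \<cdot> (Yp ks \<cdot> Zp ls) = (Yp ks \<cdot> y i) \<cdot> (Zp ls \<cdot> (z j2 \<cdot> z j))"
  proof -
    have "(b \<cdot> c) \<cdot> (Yp ks \<cdot> Zp ls) = (Yp ks \<cdot> b) \<cdot> (Zp ls \<cdot> c)" if "b \<in> Ev" "c \<in> Ev" for b c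
      using ls that by (simp add: Ev_ac)
    then show ?thesis by simp
  qed
  also have "\<dots> = Yp (ks @ [i]) \<cdot> Zp (ls @ [j2, j])"
    using ls by (simp add: Zp_snoc2)
  finally show "z j \<cdot> ((zz (y i) j1 j2 \<cdot> Yp ks) \<cdot> Zp ls) \<in> Q"
    using A[of "ls @ [j2, j]" j1 "ks @ [i]"] ls by simp
qed

lemma formB_alt:
  "even (length ls) \<Longrightarrow> (Yp ks \<cdot> z j) \<cdot> Zp ls = z j \<cdot> (Yp ks \<cdot> Zp ls)"
  using OEE[of "z j" "Yp ks" "Zp ls"] by (simp add: mul_comm)

lemma P_mul_Q:
  assumes "p \<in> P" "q \<in> Q"
  shows "p \<cdot> q \<in> Q"
  unfolding Q_def
proof (rule mul_span[OF assms(2)[unfolded Q_def]], unfold Q_def[symmetric])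
  fix g assume "g \<in> formsB"
  then obtain ks j ls where ls: "even (length ls)" and g: "g = z j \<cdot> (Yp ks \<cdot> Zp ls)"
    by (auto simp: formsB_def formB_alt)
  then have "p \<cdot> g = z j \<cdot> ((Yp ks \<cdot> Zp ls) \<cdot> p)"
    using OEE[of "z j" "Yp ks \<cdot> Zp ls" p] assms(1) by (simp add: mul_comm)
  then show "p \<cdot> g \<in> Q" using ls assms(1) by (simp add: z_mul_P P_mul_P)
qed

text \<open>Generators of \<open>Q\<close> have the shape \<open>z i \<cdot> e\<close> with
  \<open>e\<close> in \<open>P\<close>. By \<open>Od_mul_Od\<close> the product of two of them is
  \<open>zz\<close> applied to a product in \<open>P\<close>, so \<open>zz_P\<close>
  finishes.\<close>

lemma Q_mul_Q:
  assumes "p \<in> Q" "q \<in> Q"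
  shows "p \<cdot> q \<in> P"
proof -
  have *: "g \<cdot> h \<in> P" if gh: "g \<in> formsB" "h \<in> formsB" for g h
  proof -
    have "\<exists>i e. e \<in> P \<and> g = z i \<cdot> e" if g: "g \<in> formsB" for g
    proof -
      obtain ks j ls where ls: "even (length ls)" and "g = (Yp ks \<cdot> z j) \<cdot> Zp ls"
        using g by (auto simp: formsB_def)
      then show ?thesis using formB_alt[OF ls] formA_P[OF ls] by blast
    qed
    then obtain i j e f where "e \<in> P" "f \<in> P" "g = z i \<cdot> e" "h = z j \<cdot> f"
      using gh by metis
    then show ?thesis by (simp add: Od_mul_Od zz_P P_mul_P)
  qed
  have "q \<cdot> g \<in> P" if "g \<in> formsB" for g
    using mul_span[OF assms(2)[unfolded Q_def], of g "formsA \<union> formsC"] that *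
    by (simp add: P_def mul_comm)
  then show ?thesis
    using mul_span[OF assms(1)[unfolded Q_def], of q "formsA \<union> formsC"]
    by (simp add: P_def mul_comm)
qed

section \<open>Reordering factors into the sorted forms\<close>

abbreviation "R u ls \<equiv> foldl (\<lambda>u l. u \<cdot> z l) u ls"

lemma R_permuted: "mset ls = mset ls' \<Longrightarrow> R u ls = R u ls'"
  by (rule foldl_permuted_eq) (simp_all add: Od_right_comm)

lemma Zp_eq_R: "Zp ls = R \<one> ls"
  by (simp add: Zp_def foldl_map)

lemma Yp_permuted: "mset ks = mset ks' \<Longrightarrow> Yp ks = Yp ks'"
  unfolding Yp_def foldl_map by (rule foldl_permuted_eq) (simp_all add: Ev_right_comm)

text \<open>On odd elements (by \<open>OOO\<close>) and on \<open>W\<close> (by \<open>W_D\<close>)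
  the factor \<open>Zp ls\<close> can be applied one variable at a time. All odd indices then form
  one list, which \<open>R_permuted\<close> can reorder.\<close>

lemma mul_Zp:
  assumes "even (length ls)"
  shows mul_Zp_Od: "u \<in> Od \<Longrightarrow> u \<cdot> Zp ls = R u ls"
    and mul_Zp_W: "w \<in> W \<Longrightarrow> w \<cdot> Zp ls = R w ls"
proof -
  have "u \<cdot> Zp ls = R u ls \<and> R u ls \<in> Od" if "u \<in> Od"
    using assms
  proof (induction ls rule: even_length_induct)
    case (snoc2 ls a b)
    then have "u \<cdot> Zp (ls @ [a, b]) = R u ls \<cdot> (z a \<cdot> z b)"
      using that by (simp add: Zp_snoc2 OEE[symmetric])
    with snoc2 show ?case by (simp add: OOO)
  qed (simp add: that unit_right)
  then show "u \<in> Od \<Longrightarrow> u \<cdot> Zp ls = R u ls" by blast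
  have "w \<cdot> Zp ls = R w ls \<and> R w ls \<in> W" if "w \<in> W"
    using assms
  proof (induction ls rule: even_length_induct)
    case (snoc2 ls a b)
    then have "w \<cdot> Zp (ls @ [a, b]) = R w ls \<cdot> (z a \<cdot> z b)"
      using that by (simp add: Zp_snoc2 EEE[symmetric])
    moreover have "R w (ls @ [a, b]) = R w ls \<cdot> (z a \<cdot> z b)"
      using snoc2 by (simp add: W_D)
    moreover have "R w (ls @ [a, b]) \<in> W"
      using snoc2 by simp
    ultimately show ?case by simp
  qed (simp add: that unit_right)
  then show "w \<in> W \<Longrightarrow> w \<cdot> Zp ls = R w ls" by blast
qed

definition sorted_forms where
  "sorted_forms =
    {Yp ks \<cdot> Zp ls | ks ls. sorted ks \<and> even (length ls) \<and> sorted ls} \<union>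
    {(Yp ks \<cdot> z j1) \<cdot> Zp ls | ks j1 ls. sorted ks \<and> even (length ls) \<and> sorted (j1 # ls)} \<union>
    {(zz (y i) j1 j2 \<cdot> Yp ks) \<cdot> Zp ls | i j1 j2 ks ls.
       sorted ks \<and> even (length ls) \<and> sorted (j1 # j2 # ls)}"

text \<open>In (b) and (c) the separate indices \<open>j\<close> or \<open>j1\<close>,
  \<open>j2\<close> are merged with \<open>ls\<close>, the whole list is sorted, and its first one
  or two entries are split off again.\<close>

lemma forms_sorted: "formsA \<union> formsB \<union> formsC \<subseteq> sorted_forms"
proof (intro Un_least subsetI)
  fix x assume "x \<in> formsA"
  then obtain ks ls where "even (length ls)" "x = Yp ks \<cdot> Zp ls"
    by (auto simp: formsA_def)
  moreover have "Yp (sort ks) = Yp ks" "Zp (sort ls) = Zp ls"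
    by (auto intro!: Yp_permuted simp: Zp_eq_R R_permuted[of "sort ls" ls])
  ultimately show "x \<in> sorted_forms"
    unfolding sorted_forms_def by (intro UnI1 CollectI exI[of _ "sort ks"] exI[of _ "sort ls"]) simp
next
  fix x assume "x \<in> formsB"
  then obtain ks j ls where ls: "even (length ls)" "x = (Yp ks \<cdot> z j) \<cdot> Zp ls"
    by (auto simp: formsB_def)
  obtain j' ls' where s: "sort (j # ls) = j' # ls'" by (cases "sort (j # ls)") auto
  then have m: "mset (j # ls) = mset (j' # ls')" by (metis mset_sort)
  then have l: "even (length ls')" using ls by (metis length_Cons mset_eq_length even_Suc)
  have "x = R (Yp ks) (j # ls)" using ls by (simp add: mul_Zp_Od)
  also have "\<dots> = R (Yp ks) (j' # ls')" using m by (rule R_permuted)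
  also have "\<dots> = (Yp ks \<cdot> z j') \<cdot> Zp ls'" using l by (simp add: mul_Zp_Od)
  also have "Yp ks = Yp (sort ks)" by (rule Yp_permuted) simp
  finally have "x = (Yp (sort ks) \<cdot> z j') \<cdot> Zp ls'" .
  moreover have "sorted (j' # ls')" using s by (metis sorted_sort)
  ultimately show "x \<in> sorted_forms"
    unfolding sorted_forms_def using l
    by (intro UnI1 UnI2 CollectI exI[of _ "sort ks"] exI[of _ "j'"] exI[of _ "ls'"]) simp
next
  fix x assume "x \<in> formsC"
  then obtain i j1 j2 ks ls where ls: "even (length ls)"
      and x: "x = (zz (y i) j1 j2 \<cdot> Yp ks) \<cdot> Zp ls"
    by (auto simp: formsC_def)
  obtain j1' j2' ls' where s: "sort (j1 # j2 # ls) = j1' # j2' # ls'"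
    by (metis length_sort length_Suc_conv)
  then have m: "mset (j1 # j2 # ls) = mset (j1' # j2' # ls')" by (metis mset_sort)
  then have l: "even (length ls')" using ls by (metis length_Cons mset_eq_length even_Suc)
  \<comment> \<open>Moving \<open>Yp ks\<close> to the front leaves the odd factors of the core and
    of \<open>Zp ls\<close> uninterrupted.\<close>
  have C: "(zz (y i) j1 j2 \<cdot> Yp ks) \<cdot> Zp ls = Yp ks \<cdot> R (y i) (j1 # j2 # ls)"
    if "even (length ls)" for j1 j2 ks ls
  proof -
    have "(zz (y i) j1 j2 \<cdot> Yp ks) \<cdot> Zp ls = Yp ks \<cdot> (zz (y i) j1 j2 \<cdot> Zp ls)"
      using that EEE[of "Yp ks" "zz (y i) j1 j2" "Zp ls"] by (simp add: mul_comm)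
    also have "zz (y i) j1 j2 \<cdot> Zp ls = R (y i) (j1 # j2 # ls)"
      using that by (simp add: mul_Zp_W)
    finally show ?thesis .
  qed
  have "x = Yp ks \<cdot> R (y i) (j1 # j2 # ls)" using ls x by (simp only: C)
  also have "R (y i) (j1 # j2 # ls) = R (y i) (j1' # j2' # ls')" using m by (rule R_permuted)
  also have "Yp ks = Yp (sort ks)" by (rule Yp_permuted) simp
  finally have "x = (zz (y i) j1' j2' \<cdot> Yp (sort ks)) \<cdot> Zp ls'" using l by (simp only: C)
  moreover have "sorted (j1' # j2' # ls')" using s by (metis sorted_sort)
  ultimately show "x \<in> sorted_forms"
    unfolding sorted_forms_def using l
    by (intro UnI2 CollectI exI[of _ i] exI[of _ "j1'"] exI[of _ "j2'"] exI[of _ "sort ks"]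
        exI[of _ "ls'"]) simp
qed

text \<open>The hypothesis \<open>gen\<close> says that the unit and the \<open>y i\<close>,
  \<open>z i\<close> generate the algebra. The sum of \<open>P\<close> and \<open>Q\<close> contains
  them and is closed under products.\<close>

theorem span_sorted_forms:
  assumes gen: "\<And>V. subspace V \<Longrightarrow> \<one> \<in> V \<Longrightarrow> (\<And>i. y i \<in> V) \<Longrightarrow> (\<And>i. z i \<in> V) \<Longrightarrow>
    (\<And>a b. a \<in> V \<Longrightarrow> b \<in> V \<Longrightarrow> a \<cdot> b \<in> V) \<Longrightarrow> V = UNIV"
  shows "span sorted_forms = UNIV"
proof -
  let ?V = "{p + q | p q. p \<in> P \<and> q \<in> Q}"
  have V_I: "p + q \<in> ?V" if "p \<in> P" "q \<in> Q" for p q using that by blast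
  have "?V = UNIV"
  proof (rule gen)
    show "subspace ?V" using subspace_sums subspace_P subspace_Q .
    show "\<one> \<in> ?V" using V_I[OF unit_P subspace_0[OF subspace_Q]] by simp
    show "y i \<in> ?V" for i using V_I[OF y_P subspace_0[OF subspace_Q]] by simp
    have "z i \<in> Q" for i using z_mul_P[OF unit_P] by (simp add: unit_right)
    then show "z i \<in> ?V" for i using V_I[OF subspace_0[OF subspace_P]] by simp
    fix a b assume "a \<in> ?V" "b \<in> ?V"
    then obtain p q p' q' where "p \<in> P" "q \<in> Q" "p' \<in> P" "q' \<in> Q" "a = p + q" "b = p' + q'"
      by blast
    moreover from this have "a \<cdot> b = (p \<cdot> p' + q \<cdot> q') + (p \<cdot> q' + p' \<cdot> q)"
      by (simp add: mul_add_left mul_add_right mul_comm[of q p'])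
    moreover have "p \<cdot> p' + q \<cdot> q' \<in> P" "p \<cdot> q' + p' \<cdot> q \<in> Q"
      if "p \<in> P" "q \<in> Q" "p' \<in> P" "q' \<in> Q"
      using that by (simp_all add: subspace_add subspace_P subspace_Q P_mul_P P_mul_Q Q_mul_Q)
    ultimately show "a \<cdot> b \<in> ?V" using V_I by presburger
  qed
  moreover have "P \<subseteq> span sorted_forms" "Q \<subseteq> span sorted_forms"
    unfolding P_def Q_def using forms_sorted by (auto intro!: span_mono)
  then have "?V \<subseteq> span sorted_forms" by (auto intro: span_add)
  ultimately show ?thesis by blast
qed

end
section \<open>Graded substitutions and the quotient algebra\<close>

lemma subspace_J_component: "J.subspace (J_component d)"
  by (simp add: J_component_def)

lemma monomial_J_component: "monomial_of_degree d u \<Longrightarrow> u \<in> J_component d"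
  by (simp add: J_component_def J.span_base)

lemma one_J_component: "1 \<in> J_component 0"
  and y_J_component: "y i \<in> J_component 0"
  and z_J_component: "z i \<in> J_component 1"
  by (intro monomial_J_component monomial_of_degree.intros)+

lemma mul_J_component:
  assumes "a \<in> J_component d" "b \<in> J_component e"
  shows "a * b \<in> J_component (d + e)"
proof -
  have "u * b \<in> J_component (d + e)" if "monomial_of_degree d u" for u
    using assms(2) unfolding J_component_def
    by (rule J.mul_span) (use that in \<open>blast intro: J.span_base monomial_of_degree.intros(4)\<close>)
  then have "b * a \<in> J_component (d + e)"
    using J.mul_span[OF assms(1)[unfolded J_component_def], of b]
    by (simp add: J_component_def J.mul_comm[of b])
  then show ?thesis by (simp add: J.mul_comm[of a])
qed

lemma J_component_decomp: "\<exists>a\<in>J_component 0. \<exists>b\<in>J_component 1. f = a + b"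
proof -
  have I: "\<exists>a\<in>J_component 0. \<exists>b\<in>J_component 1. f = a + b"
    if "f = a + b" "a \<in> J_component 0" "b \<in> J_component 1" for f a b :: "'a jpoly"
    using that by blast
  show ?thesis
  proof (induction f rule: free_jordan_induct)
    case (var x)
    show ?case
    proof (cases x)
      case (Y i)
      then show ?thesis
        using I[of "var x" "y i" 0] by (simp add: y_J_component J.subspace_0 subspace_J_component)
    next
      case (Z i)
      then show ?thesis
        using I[of "var x" 0 "z i"] by (simp add: z_J_component J.subspace_0 subspace_J_component)
    qed
  next
    case one
    show ?case using I[of 1 1 0] by (simp add: one_J_component J.subspace_0 subspace_J_component)
  next
    case zero
    show ?case using I[of 0 0 0] by (simp add: J.subspace_0 subspace_J_component)
  next
    case (add f g)
    then obtain a b a' b' where "a \<in> J_component 0" "b \<in> J_component 1" "f = a + b"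
      "a' \<in> J_component 0" "b' \<in> J_component 1" "g = a' + b'" by blast
    then show ?case
      by (intro I[of _ "a + a'" "b + b'"]) (simp_all add: J.subspace_add subspace_J_component)
  next
    case (neg f)
    then obtain a b where "a \<in> J_component 0" "b \<in> J_component 1" "f = a + b" by blast
    then show ?case
      by (intro I[of _ "- a" "- b"]) (simp_all add: J.subspace_neg subspace_J_component)
  next
    case (scale r f)
    then obtain a b where "a \<in> J_component 0" "b \<in> J_component 1" "f = a + b" by blast
    then show ?case
      by (intro I[of _ "scaleJ r a" "scaleJ r b"])
        (simp_all add: J.scale_right_distrib J.subspace_scale subspace_J_component)
  next
    case (mul f g)
    then obtain a b a' b' where ab: "a \<in> J_component 0" "b \<in> J_component 1" "f = a + b"
      "a' \<in> J_component 0" "b' \<in> J_component 1" "g = a' + b'" by blast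
    have "a * a' + b * b' \<in> J_component 0" "a * b' + b * a' \<in> J_component 1"
      using ab mul_J_component[of a 0 a' 0] mul_J_component[of b 1 b' 1]
        mul_J_component[of a 0 b' 1] mul_J_component[of b 1 a' 0]
      by (simp_all add: J.subspace_add subspace_J_component)
    then show ?case
      by (rule I[rotated]) (simp add: ab J.mul_add_left J.mul_add_right)
  qed
qed

context unital_jordan_algebra
begin

lemma eval_simps:
  "eval scl mul unit \<rho> (f + g) = eval scl mul unit \<rho> f + eval scl mul unit \<rho> g"
  "eval scl mul unit \<rho> (f - g) = eval scl mul unit \<rho> f - eval scl mul unit \<rho> g"
  "eval scl mul unit \<rho> (scaleJ r f) = scl r (eval scl mul unit \<rho> f)"
  "eval scl mul unit \<rho> 0 = 0"
  "eval scl mul unit \<rho> (f * g) = mul (eval scl mul unit \<rho> f) (eval scl mul unit \<rho> g)"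
  "eval scl mul unit \<rho> 1 = unit"
  "eval scl mul unit \<rho> (\<Sum>i\<in>A. F i) = (\<Sum>i\<in>A. eval scl mul unit \<rho> (F i))"
proof -
  have hom: "algebra_hom scaleJ (*) 1 scl mul unit (eval scl mul unit \<rho>)"
    by (rule eval_hom)
  interpret e: Vector_Spaces.linear scaleJ scl "eval scl mul unit \<rho>"
    using hom by (simp add: algebra_hom_def)
  show "eval scl mul unit \<rho> (f + g) = eval scl mul unit \<rho> f + eval scl mul unit \<rho> g"
    "eval scl mul unit \<rho> (f - g) = eval scl mul unit \<rho> f - eval scl mul unit \<rho> g"
    "eval scl mul unit \<rho> (scaleJ r f) = scl r (eval scl mul unit \<rho> f)"
    "eval scl mul unit \<rho> 0 = 0"
    "eval scl mul unit \<rho> (\<Sum>i\<in>A. F i) = (\<Sum>i\<in>A. eval scl mul unit \<rho> (F i))"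
    by (fact e.add e.diff e.scale e.zero e.sum)+
  show "eval scl mul unit \<rho> (f * g) = mul (eval scl mul unit \<rho> f) (eval scl mul unit \<rho> g)"
    "eval scl mul unit \<rho> 1 = unit"
    using hom by (simp_all add: algebra_hom_def)
qed

text \<open>The grading \<open>C\<close> of the target is arbitrary, so that this serves both
  endomorphisms of the free algebra and evaluation in matrices.\<close>

lemma eval_J_component:
  assumes C: "\<And>d. subspace (C d)" "unit \<in> C 0"
      "\<And>d e u v. u \<in> C d \<Longrightarrow> v \<in> C e \<Longrightarrow> mul u v \<in> C (d + e)"
    and \<rho>: "\<And>i. \<rho> (Y i) \<in> C 0" "\<And>i. \<rho> (Z i) \<in> C 1"
    and "f \<in> J_component d"
  shows "eval scl mul unit \<rho> f \<in> C d"
proof -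
  have mon: "eval scl mul unit \<rho> u \<in> C d" if "monomial_of_degree d u" for u :: "'k jpoly" and d
    using that
  proof induction
    case (4 d u e v)
    then show ?case by (simp only: eval_simps C(3))
  qed (simp_all add: eval_simps eval_var assms)
  show ?thesis
    using assms(6) unfolding J_component_def
    by (induction rule: J.span_induct_alt)
      (auto simp: eval_simps subspace_0[OF C(1)] intro!: subspace_add[OF C(1)]
        subspace_scale[OF C(1)] mon)
qed

end

lemma graded_endomorphism_eval:
  assumes "\<And>i. \<rho> (Y i) \<in> J_component 0" "\<And>i. \<rho> (Z i) \<in> J_component 1"
  shows "graded_endomorphism (eval scaleJ (*) 1 \<rho>)"
  unfolding graded_endomorphism_def
  using J.eval_hom[of \<rho>]
    J.eval_J_component[of J_component \<rho>, OF subspace_J_component one_J_component mul_J_component assms]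
  by blast

section \<open>Homogeneous substitution instances of the generators\<close>

lemma T_ideal_I_Ass: "T_ideal I_Ass"
  unfolding I_Ass_def by (rule T_ideal_T_ideal_generated)

lemma eval_I_Ass:
  assumes "f \<in> I_Ass" "\<And>i. \<rho> (Y i) \<in> J_component 0" "\<And>i. \<rho> (Z i) \<in> J_component 1"
  shows "eval scaleJ (*) 1 \<rho> f \<in> I_Ass"
proof -
  have "eval scaleJ (*) 1 \<rho> ` I_Ass \<subseteq> I_Ass"
    using T_ideal_I_Ass graded_endomorphism_eval[of \<rho>] assms(2,3) unfolding T_ideal_def by blast
  then show ?thesis using assms(1) by blast
qed

lemma eval_associator:
  "eval scaleJ (*) 1 \<rho> (associator a b c) =
    associator (eval scaleJ (*) 1 \<rho> a) (eval scaleJ (*) 1 \<rho> b) (eval scaleJ (*) 1 \<rho> c)"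
  by (simp add: associator_def J.eval_simps)

lemma associators_I_Ass:
  fixes a b c u v w x :: "'k::field jpoly"
  shows "a \<in> J_component 0 \<Longrightarrow> b \<in> J_component 0 \<Longrightarrow> c \<in> J_component 0 \<Longrightarrow>
      associator a b c \<in> I_Ass"
    and "u \<in> J_component 1 \<Longrightarrow> a \<in> J_component 0 \<Longrightarrow> b \<in> J_component 0 \<Longrightarrow>
      associator u a b \<in> I_Ass"
    and "u \<in> J_component 1 \<Longrightarrow> a \<in> J_component 0 \<Longrightarrow> v \<in> J_component 1 \<Longrightarrow>
      associator u a v \<in> I_Ass"
    and "u \<in> J_component 1 \<Longrightarrow> v \<in> J_component 1 \<Longrightarrow> w \<in> J_component 1 \<Longrightarrow>
      associator u v w \<in> I_Ass"
    and "u \<in> J_component 1 \<Longrightarrow> v \<in> J_component 1 \<Longrightarrow> w \<in> J_component 1 \<Longrightarrow> x \<in> J_component 1 \<Longrightarrow>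
      associator (u * v) w x \<in> I_Ass"
proof -
  \<comment> \<open>One substitution serves all five generators. The variables that a generator does
    not contain are sent to 0, which is homogeneous of both degrees.\<close>
  define \<rho> where "\<rho> a b c u v w x X = (case X of
      Y i \<Rightarrow> if i = 1 then a else if i = 2 then b else c
    | Z i \<Rightarrow> if i = 1 then u else if i = 2 then v else if i = 3 then w else x)"
    for a b c u v w x :: "'k jpoly" and X
  have *: "eval scaleJ (*) 1 (\<rho> a b c u v w x) f \<in> I_Ass"
    if "f \<in> I_Ass" "a \<in> J_component 0" "b \<in> J_component 0" "c \<in> J_component 0"
      "u \<in> J_component 1" "v \<in> J_component 1" "w \<in> J_component 1" "x \<in> J_component 1"
    for a b c u v w x f
    by (rule eval_I_Ass[OF that(1)]) (simp_all add: \<rho>_def that)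
  have gen: "{associator (y 1) (y 2) (y 3), associator (z 1) (y 1) (y 2), associator (z 1) (y 1) (z 2),
     associator (z 1) (z 2) (z 3), associator (z 1 * z 2) (z 3) (z 4)} \<subseteq> (I_Ass :: 'k jpoly set)"
    unfolding I_Ass_def by (rule T_ideal_generated_superset)
  note zero = J.subspace_0[OF subspace_J_component]
  note \<rho>_simps = eval_associator J.eval_simps J.eval_var \<rho>_def
  show "associator a b c \<in> I_Ass"
    if "a \<in> J_component 0" "b \<in> J_component 0" "c \<in> J_component 0"
    using *[OF _ that zero zero zero zero, of "associator (y 1) (y 2) (y 3)"] gen
    by (simp add: \<rho>_simps)
  show "associator u a b \<in> I_Ass"
    if "u \<in> J_component 1" "a \<in> J_component 0" "b \<in> J_component 0"
    using *[OF _ that(2,3) zero that(1) zero zero zero, of "associator (z 1) (y 1) (y 2)"] gen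
    by (simp add: \<rho>_simps)
  show "associator u a v \<in> I_Ass"
    if "u \<in> J_component 1" "a \<in> J_component 0" "v \<in> J_component 1"
    using *[OF _ that(2) zero zero that(1,3) zero zero, of "associator (z 1) (y 1) (z 2)"] gen
    by (simp add: \<rho>_simps)
  show "associator u v w \<in> I_Ass"
    if "u \<in> J_component 1" "v \<in> J_component 1" "w \<in> J_component 1"
    using *[OF _ zero zero zero that zero, of "associator (z 1) (z 2) (z 3)"] gen
    by (simp add: \<rho>_simps)
  show "associator (u * v) w x \<in> I_Ass"
    if "u \<in> J_component 1" "v \<in> J_component 1" "w \<in> J_component 1" "x \<in> J_component 1"
    using *[OF _ zero zero zero that, of "associator (z 1 * z 2) (z 3) (z 4)"] gen
    by (simp add: \<rho>_simps)
qed

section \<open>The quotient as a graded Jordan algebra\<close>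

lift_definition mulQ :: "'k::field J_mod_I \<Rightarrow> 'k J_mod_I \<Rightarrow> 'k J_mod_I" is "(*)"
proof -
  fix f f' g g' :: "'k jpoly"
  assume "f - f' \<in> I_Ass" "g - g' \<in> I_Ass"
  then have "(f - f') * g + f' * (g - g') \<in> I_Ass"
    using T_ideal_I_Ass J.subspace_add[OF subspace_I_Ass] unfolding T_ideal_def by blast
  then show "f * g - f' * g' \<in> I_Ass"
    by (simp add: J.mul_diff_left J.mul_diff_right)
qed

interpretation Q: unital_jordan_algebra scaleQ "mulQ :: 'k::field J_mod_I \<Rightarrow> _" "coset 1"
proof
  fix r :: 'k and a b c :: "'k J_mod_I"
  note zero = J.subspace_0[OF subspace_I_Ass]
  show "mulQ a b = mulQ b a"
    by transfer (simp add: zero J.mul_comm)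
  show "mulQ (a + b) c = mulQ a c + mulQ b c"
    by transfer (simp add: zero J.mul_add_left)
  show "mulQ (scaleQ r a) b = scaleQ r (mulQ a b)"
    by transfer (simp add: zero J.mul_scale_left)
  show "mulQ (coset 1) a = a"
    by transfer (simp add: zero J.unit_left)
  show "mulQ (mulQ (mulQ a a) b) a = mulQ (mulQ a a) (mulQ b a)"
    by transfer (simp add: zero J.jordan)
qed

interpretation coset: Vector_Spaces.linear scaleJ scaleQ coset
  by (rule coset_linear)

lemma coset_mul: "coset (f * g) = mulQ (coset f) (coset g)"
  by transfer (simp add: J.subspace_0[OF subspace_I_Ass])

lemma coset_associator:
  "associator f g h \<in> I_Ass \<Longrightarrow>
    mulQ (mulQ (coset f) (coset g)) (coset h) = mulQ (coset f) (mulQ (coset g) (coset h))"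
  by (simp add: associator_def coset_mul[symmetric] coset_eq_iff)

lemma quotient_generated:
  fixes V :: "'k::field J_mod_I set"
  assumes V: "Q.subspace V" "coset 1 \<in> V" "\<And>i. coset (y i) \<in> V" "\<And>i. coset (z i) \<in> V"
    and mul: "\<And>a b. a \<in> V \<Longrightarrow> b \<in> V \<Longrightarrow> mulQ a b \<in> V"
  shows "V = UNIV"
proof -
  have "coset f \<in> V" for f
  proof (induction f rule: free_jordan_induct)
    case (var x)
    then show ?case using V by (cases x) auto
  qed (simp_all add: V mul coset_mul coset.zero coset.add coset.neg coset.scale
      Q.subspace_0 Q.subspace_add Q.subspace_neg Q.subspace_scale)
  then show ?thesis using coset_surj by (metis UNIV_eq_I surjD)
qed

lemma quotient_ass_graded_jordan:
  assumes "CHAR('k::field) \<noteq> 2"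
  shows "ass_graded_jordan_generators scaleQ mulQ (coset (1 :: 'k jpoly))
    (coset ` J_component 0) (coset ` J_component 1) (\<lambda>i. coset (y i)) (\<lambda>i. coset (z i))"
proof
  show "(2::'k) \<noteq> 0" using assms by (rule two_neq_0)
  have "Q.subspace (coset ` J_component d :: 'k J_mod_I set)" for d :: bit
    by (rule coset.subspace_image) (rule subspace_J_component)
  then show "Q.subspace (coset ` J_component 0 :: 'k J_mod_I set)"
    "Q.subspace (coset ` J_component 1 :: 'k J_mod_I set)"
    by blast+
  show "\<exists>a\<in>coset ` J_component 0. \<exists>u\<in>coset ` J_component 1. x = a + u" for x :: "'k J_mod_I"
  proof -
    obtain f where "x = coset f" using coset_surj by (metis surjD)
    moreover obtain a b where "a \<in> J_component 0" "b \<in> J_component 1" "f = a + b"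
      using J_component_decomp by blast
    ultimately show ?thesis using coset.add[of a b] by blast
  qed
  note mul = mul_J_component[where d = 0 and e = 0, simplified]
    mul_J_component[where d = 0 and e = 1, simplified]
    mul_J_component[where d = 1 and e = 1, simplified]
  show "mulQ a b \<in> coset ` J_component 0" if "a \<in> coset ` J_component 0" "b \<in> coset ` J_component 0"
    for a b :: "'k J_mod_I"
    using that by (auto simp: coset_mul[symmetric] intro: mul)
  show "mulQ a b \<in> coset ` J_component 1" if "a \<in> coset ` J_component 0" "b \<in> coset ` J_component 1"
    for a b :: "'k J_mod_I"
    using that by (auto simp: coset_mul[symmetric] intro: mul)
  show "mulQ a b \<in> coset ` J_component 0" if "a \<in> coset ` J_component 1" "b \<in> coset ` J_component 1"
    for a b :: "'k J_mod_I"
    using that by (auto simp: coset_mul[symmetric] intro: mul)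
qed (auto simp: coset_mul[symmetric] one_J_component y_J_component z_J_component
    intro!: coset_associator[folded coset_mul]
    intro: associators_I_Ass)

lemma image_setcompr:
  "h ` {f a b | a b. P a b} = {h (f a b) | a b. P a b}"
  "h ` {f' a b c | a b c. P' a b c} = {h (f' a b c) | a b c. P' a b c}"
  "h ` {f'' a b c d e | a b c d e. P'' a b c d e} = {h (f'' a b c d e) | a b c d e. P'' a b c d e}"
  by blast+

lemma span_coset_S_Ass:
  assumes "CHAR('k::field) \<noteq> 2"
  shows "Q.span (coset ` (S_Ass :: 'k jpoly set)) = UNIV"
proof -
  interpret G: ass_graded_jordan_generators scaleQ mulQ "coset (1 :: 'k jpoly)"
    "coset ` J_component 0" "coset ` J_component 1" "\<lambda>i. coset (y i)" "\<lambda>i. coset (z i)"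
    using assms by (rule quotient_ass_graded_jordan)
  have "coset (left_normed (map f ks)) = foldl mulQ (coset 1) (map (\<lambda>i. coset (f i)) ks)"
    for f :: "nat \<Rightarrow> 'k jpoly" and ks
    by (induction ks rule: rev_induct) (simp_all add: left_normed_def coset_mul)
  then have *: "G.Yp ks = coset (y_prod ks)" "G.Zp ks = coset (z_prod ks)" for ks
    by (simp_all add: G.Yp_def G.Zp_def)
  have "coset ` S_Ass = G.sorted_forms"
    unfolding S_Ass_def G.sorted_forms_def image_Un image_setcompr * coset_mul[symmetric] ..
  moreover have "Q.span G.sorted_forms = UNIV"
    by (rule G.span_sorted_forms) (rule quotient_generated)
  ultimately show ?thesis by (simp only:)
qed

section \<open>Linear independence of monomial functions\<close>

text \<open>Artin's argument: comparing the relation at \<open>g \<cdot> h\<close> with its multiple by \<open>f\<^sub>j(g)\<close>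
  eliminates the character \<open>f\<^sub>j\<close>.\<close>

lemma characters_independent:
  fixes f :: "'i \<Rightarrow> 'm \<Rightarrow> 'k::field"
  assumes "finite F"
    and "\<And>i g h. i \<in> F \<Longrightarrow> f i (m g h) = f i g * f i h"
    and "\<And>i. i \<in> F \<Longrightarrow> f i e \<noteq> 0"
    and "\<And>i j. i \<in> F \<Longrightarrow> j \<in> F \<Longrightarrow> i \<noteq> j \<Longrightarrow> \<exists>g. f i g \<noteq> f j g"
    and "\<And>g. (\<Sum>i\<in>F. c i * f i g) = 0"
    and "i \<in> F"
  shows "c i = 0"
  using assms
proof (induction F arbitrary: c i rule: finite_induct)
  case (insert j F)
  have F: "c i = 0" if i: "i \<in> F" for i
  proof -
    obtain g where g: "f i g \<noteq> f j g"
      using insert.prems(3)[of i j] i insert.hyps(2) by auto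
    have "(\<Sum>i\<in>F. (c i * (f i g - f j g)) * f i h) = 0" for h
    proof -
      have "(\<Sum>i\<in>F. (c i * (f i g - f j g)) * f i h) =
          (\<Sum>i\<in>insert j F. (c i * (f i g - f j g)) * f i h)"
        using insert.hyps by simp
      also have "\<dots> = (\<Sum>i\<in>insert j F. c i * f i (m g h) - f j g * (c i * f i h))"
        by (rule sum.cong) (auto simp: insert.prems(1) algebra_simps)
      also have "\<dots> = (\<Sum>i\<in>insert j F. c i * f i (m g h)) - f j g * (\<Sum>i\<in>insert j F. c i * f i h)"
        by (simp only: sum_subtractf sum_distrib_left)
      also have "\<dots> = 0"
        by (simp only: insert.prems(4) mult_zero_right diff_self)
      finally show ?thesis .
    qed
    then have "c i * (f i g - f j g) = 0"
      using insert.IH[of "\<lambda>i. c i * (f i g - f j g)" i] insert.prems i by auto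
    then show ?thesis using g by simp
  qed
  have "c j * f j e = 0"
    using insert.prems(4)[of e] insert.hyps F by simp
  then have "c j = 0" using insert.prems(2)[of j] by simp
  then show ?case using F insert.prems(5) by auto
qed simp

abbreviation monomial_at :: "('x \<Rightarrow> 'k::comm_monoid_mult) \<Rightarrow> 'x multiset \<Rightarrow> 'k" where
  "monomial_at v w \<equiv> prod_mset (image_mset v w)"

text \<open>A nonzero polynomial has finitely many roots; this is where infinity of the field
  enters.\<close>

lemma power_neq_power:
  assumes "infinite (UNIV :: 'k::field set)" "a \<noteq> b"
  obtains s :: "'k::field" where "s ^ a \<noteq> s ^ b"
proof -
  let ?p = "monom 1 a - monom 1 b :: 'k poly"
  have "coeff ?p a \<noteq> 0" using assms(2) by simp
  then have "?p \<noteq> 0" by (metis coeff_0)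
  then have "finite {s. poly ?p s = 0}" by (rule poly_roots_finite)
  then obtain s where "poly ?p s \<noteq> 0"
    using assms(1) by (metis (mono_tags, lifting) UNIV_eq_I mem_Collect_eq)
  then show thesis using that by (simp add: poly_monom)
qed

lemma monomial_at_indicator:
  "monomial_at (\<lambda>x'. if x' = x then s else 1) w = (s :: 'k::comm_monoid_mult) ^ count w x"
  by (induction w) auto

lemma monomials_distinct:
  assumes "infinite (UNIV :: 'k::field set)" "w \<noteq> w'"
  obtains v :: "'x \<Rightarrow> 'k::field" where "monomial_at v w \<noteq> monomial_at v w'"
proof -
  obtain x where "count w x \<noteq> count w' x" using assms(2) by (auto simp: multiset_eq_iff)
  then obtain s :: 'k where "s ^ count w x \<noteq> s ^ count w' x"
    using power_neq_power[OF assms(1)] by blast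
  then show thesis using that by (metis monomial_at_indicator)
qed

text \<open>A relation between monomial functions is a formal one: after grouping equal monomials
  all coefficients vanish. Hence evaluation may be replaced by any function \<open>g\<close> of the
  monomial, such as a derivative or an indicator.\<close>

lemma monomial_sum_transfer:
  fixes c :: "'i \<Rightarrow> 'k::field" and mon :: "'i \<Rightarrow> 'x multiset"
  assumes "infinite (UNIV :: 'k set)" "finite F"
    and zero: "\<And>v. (\<Sum>t\<in>F. c t * monomial_at v (mon t)) = 0"
  shows "(\<Sum>t\<in>F. c t * g (mon t)) = 0"
proof -
  define C where "C w = (\<Sum>t\<in>{t\<in>F. mon t = w}. c t)" for w
  have group: "(\<Sum>t\<in>F. c t * h (mon t)) = (\<Sum>w\<in>mon ` F. C w * h w)" for h
  proof -
    have "(\<Sum>t\<in>F. c t * h (mon t)) = (\<Sum>w\<in>mon ` F. \<Sum>t\<in>{t\<in>F. mon t = w}. c t * h (mon t))"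
      using assms(2) by (rule sum.image_gen)
    also have "\<dots> = (\<Sum>w\<in>mon ` F. C w * h w)"
      by (rule sum.cong) (auto simp: C_def sum_distrib_right)
    finally show ?thesis .
  qed
  have "C w = 0" if "w \<in> mon ` F" for w
  \<comment> \<open>Monomials are characters of the monoid of assignments under pointwise
    multiplication.\<close>
  proof (rule characters_independent[where F = "mon ` F" and f = "\<lambda>w v. monomial_at v w"
        and m = "\<lambda>v v' x. v x * v' x" and e = "\<lambda>_. 1"])
    show "(\<Sum>w\<in>mon ` F. C w * monomial_at v w) = 0" for v
      by (simp only: zero group[symmetric])
    show "\<exists>v :: 'x \<Rightarrow> 'k. monomial_at v w \<noteq> monomial_at v w'" if "w \<noteq> w'" for w w'
      using monomials_distinct[OF assms(1) that] by blast
    show "monomial_at (\<lambda>x. v x * v' x) w = monomial_at v w * monomial_at v' w"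
      for v v' :: "'x \<Rightarrow> 'k" and w
      by (simp add: prod_mset.distrib)
  qed (use that assms(2) in \<open>auto simp: image_mset_const_eq\<close>)
  then show ?thesis by (simp add: group)
qed

text \<open>Distinct indices may share a monomial, provided that the competing coefficients are
  known to vanish. The transfer is applied to the indicator of \<open>mon t0\<close>.\<close>

lemma monomial_coefficient_zero:
  fixes c :: "'i \<Rightarrow> 'k::field" and mon :: "'i \<Rightarrow> 'x multiset"
  assumes "infinite (UNIV :: 'k set)" "finite F"
    and "\<And>v. (\<Sum>t\<in>F. c t * monomial_at v (mon t)) = 0"
    and "t0 \<in> F" and other: "\<And>t. t \<in> F \<Longrightarrow> mon t = mon t0 \<Longrightarrow> t \<noteq> t0 \<Longrightarrow> c t = 0"
  shows "c t0 = 0"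
proof -
  have "(\<Sum>t\<in>F. c t * (if mon t = mon t0 then 1 else 0)) = 0"
    using monomial_sum_transfer[OF assms(1-3), of "\<lambda>w. if w = mon t0 then 1 else 0"] by simp
  also have "(\<Sum>t\<in>F. c t * (if mon t = mon t0 then 1 else 0)) = (\<Sum>t\<in>F. if t = t0 then c t0 else 0)"
    by (rule sum.cong) (auto simp: other)
  finally show ?thesis using assms(2,4) by simp
qed

text \<open>The derivative of the monomial \<open>w\<close> at the point \<open>v\<close> in
  direction \<open>d\<close>, written out by the Leibniz rule; repeated variables count with
  multiplicity.\<close>

definition derivation_at :: "('x \<Rightarrow> 'k::field) \<Rightarrow> ('x \<Rightarrow> 'k) \<Rightarrow> 'x multiset \<Rightarrow> 'k" where
  "derivation_at v d w = (\<Sum>x\<in>#w. d x * monomial_at v (w - {#x#}))"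

lemma derivation_at_empty [simp]: "derivation_at v d {#} = 0"
  by (simp add: derivation_at_def)

lemma derivation_at_add [simp]:
  "derivation_at v d (add_mset x w) = d x * monomial_at v w + v x * derivation_at v d w"
proof -
  have "(\<Sum>x'\<in>#w. d x' * monomial_at v (add_mset x w - {#x'#})) =
      (\<Sum>x'\<in>#w. v x * (d x' * monomial_at v (w - {#x'#})))"
  proof (rule arg_cong[where f = sum_mset], rule image_mset_cong)
    fix x' assume "x' \<in># w"
    then obtain w' where "w = add_mset x' w'" by (blast dest: multi_member_split)
    then have "add_mset x w - {#x'#} = add_mset x (w - {#x'#})"
      by (simp add: add_mset_commute[of x x'])
    then show "d x' * monomial_at v (add_mset x w - {#x'#}) =
        v x * (d x' * monomial_at v (w - {#x'#}))"
      by simp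
  qed
  then show ?thesis by (simp add: derivation_at_def sum_mset_distrib_left)
qed

lemma derivation_at_union:
  "derivation_at v d (w + w') =
    derivation_at v d w * monomial_at v w' + monomial_at v w * derivation_at v d w'"
  by (induction w) (simp_all add: algebra_simps)

section \<open>Values of the spanning polynomials\<close>

text \<open>\<open>tri p q r\<close> is \<open>p\<close> times the identity plus \<open>q e\<^sub>1\<^sub>2 + r (e\<^sub>1\<^sub>1 - e\<^sub>2\<^sub>2)\<close>.\<close>

definition tri :: "'k::field \<Rightarrow> 'k \<Rightarrow> 'k \<Rightarrow> 'k^2^2" where
  "tri p q r = (\<chi> i j. if i = 1 then (if j = 1 then p + r else q) else (if j = 1 then 0 else p - r))"

lemma tri_nth [simp]:
  "tri p q r $ 1 $ 1 = p + r" "tri p q r $ 1 $ 2 = q" "tri p q r $ 2 $ 1 = 0"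
  "tri p q r $ 2 $ 2 = p - r"
  by (simp_all add: tri_def)

text \<open>The matrices e12 and e11 - e22 anticommute and e12 squares to zero, so no term pairs
  \<open>q\<close> with \<open>r'\<close> or with \<open>q'\<close>.\<close>

lemma jordan_prod_tri:
  assumes "(2::'k::field) \<noteq> 0"
  shows "jordan_prod (tri p q r) (tri p' q' r' :: 'k^2^2) =
    tri (p * p' + r * r') (p * q' + p' * q) (p * r' + p' * r)"
  using assms
  by (simp add: jordan_prod_def scaleM_def vec_eq_iff forall_2 matrix_matrix_mult_def sum_2
      field_simps)

lemma tri_linear:
  "tri p q r + tri p' q' r' = tri (p + p') (q + q') (r + r')"
  "scaleM c (tri p q r) = tri (c * p) (c * q) (c * r)"
  "mat 1 = tri 1 0 0" "0 = tri 0 0 0"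
  by (simp_all add: vec_eq_iff forall_2 scaleM_def mat_def algebra_simps)

lemma sum_tri: "(\<Sum>t\<in>F. tri (p t) (q t) (r t)) = tri (sum p F) (sum q F) (sum r F)"
  by (induction F rule: infinite_finite_induct) (simp_all add: tri_linear)

lemma tri_eq_0:
  assumes "(2::'k::field) \<noteq> 0" "tri p q r = (0 :: 'k^2^2)"
  shows "p = 0" "q = 0" "r = 0"
proof -
  have "p + r = 0" "q = 0" "p - r = 0"
    using arg_cong[OF assms(2), of "\<lambda>A. A $ 1 $ 1"] arg_cong[OF assms(2), of "\<lambda>A. A $ 1 $ 2"]
      arg_cong[OF assms(2), of "\<lambda>A. A $ 2 $ 2"] by simp_all
  moreover from this have "2 * p = 0" by (simp add: algebra_simps)
  ultimately show "p = 0" "q = 0" "r = 0" using assms(1) by auto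
qed

lemma UJ2_ass_0_tri: "A \<in> UJ2_ass 0 \<longleftrightarrow> (\<exists>p q. A = tri p q 0)"
proof
  assume "A \<in> UJ2_ass 0"
  then have "A = tri (A $ 1 $ 1) (A $ 1 $ 2) 0" by (simp add: UJ2_ass_0 vec_eq_iff forall_2)
  then show "\<exists>p q. A = tri p q 0" by blast
qed (auto simp: UJ2_ass_0)

lemma UJ2_ass_1_tri: "A \<in> UJ2_ass 1 \<longleftrightarrow> (\<exists>r. A = tri 0 0 r)"
proof
  assume "A \<in> UJ2_ass 1"
  then have "A = tri 0 0 (A $ 1 $ 1)" by (simp add: UJ2_ass_1 vec_eq_iff forall_2)
  then show "\<exists>r. A = tri 0 0 r" by blast
qed (auto simp: UJ2_ass_1)

text \<open>Distinct index data could a priori give equal polynomials. Independence is therefore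
  shown for the family indexed by this type, and distinctness follows from it.\<close>

datatype form =
    FormA "nat list" "nat list"
  | FormB "nat list" nat "nat list"
  | FormC nat nat nat "nat list" "nat list"

fun form_poly :: "form \<Rightarrow> 'k::field jpoly" where
  "form_poly (FormA ks ls) = y_prod ks * z_prod ls"
| "form_poly (FormB ks j ls) = (y_prod ks * z j) * z_prod ls"
| "form_poly (FormC i j1 j2 ks ls) = (((y i * z j1) * z j2) * y_prod ks) * z_prod ls"

fun admissible :: "form \<Rightarrow> bool" where
  "admissible (FormA ks ls) \<longleftrightarrow> sorted ks \<and> even (length ls) \<and> sorted ls"
| "admissible (FormB ks j ls) \<longleftrightarrow> sorted ks \<and> even (length ls) \<and> sorted (j # ls)"
| "admissible (FormC i j1 j2 ks ls) \<longleftrightarrow> sorted ks \<and> even (length ls) \<and> sorted (j1 # j2 # ls)"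

lemma S_Ass_forms: "S_Ass = form_poly ` Collect admissible"
proof -
  have "Collect admissible =
      {FormA ks ls | ks ls. sorted ks \<and> even (length ls) \<and> sorted ls} \<union>
      {FormB ks j1 ls | ks j1 ls. sorted ks \<and> even (length ls) \<and> sorted (j1 # ls)} \<union>
      {FormC i j1 j2 ks ls | i j1 j2 ks ls.
         sorted ks \<and> even (length ls) \<and> sorted (j1 # j2 # ls)}"
    (is "_ = ?R")
  proof (rule set_eqI)
    show "t \<in> Collect admissible \<longleftrightarrow> t \<in> ?R" for t by (cases t) simp_all
  qed
  then show ?thesis by (simp only: image_Un image_setcompr form_poly.simps S_Ass_def)
qed

section \<open>The commutative monomials attached to the forms\<close>

definition word :: "nat list \<Rightarrow> nat list \<Rightarrow> gvar multiset" where
  "word ks ls = image_mset Y (mset ks) + image_mset Z (mset ls)"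

lemma word_inject:
  assumes "word ks ls = word ks' ls'" "sorted ks" "sorted ks'" "sorted ls" "sorted ls'"
  shows "ks = ks' \<and> ls = ls'"
proof -
  have "image_mset Y (mset ks) = filter_mset (\<lambda>x. \<exists>i. x = Y i) (word ks ls)"
    "image_mset Z (mset ls) = filter_mset (\<lambda>x. \<exists>i. x = Z i) (word ks ls)" for ks ls
    by (simp_all add: word_def filter_mset_image_mset)
  then have "image_mset Y (mset ks) = image_mset Y (mset ks')"
    "image_mset Z (mset ls) = image_mset Z (mset ls')"
    using assms(1) by metis+
  then have "mset ks = mset ks'" "mset ls = mset ls'"
    by (auto dest!: multiset.inj_map_strong[rotated])
  then show ?thesis
    using assms(2-) by (metis properties_for_sort sorted_sort_id)
qed

fun form_word :: "form \<Rightarrow> gvar multiset" where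
  "form_word (FormA ks ls) = word ks ls"
| "form_word (FormB ks j ls) = word ks (j # ls)"
| "form_word (FormC i j1 j2 ks ls) = word (i # ks) (j1 # j2 # ls)"

fun is_B :: "form \<Rightarrow> bool" where
  "is_B (FormB ks j ls) = True"
| "is_B _ = False"

text \<open>In type (c) the factor \<open>y\<^sub>i\<close> contributes only its scalar part to the coefficient of
  \<open>e\<^sub>1\<^sub>2\<close>; the term of the derivation lost in this way is what separates type (c)
  from type (a).\<close>

fun lost_term :: "(gvar \<Rightarrow> 'k::field) \<Rightarrow> (gvar \<Rightarrow> 'k) \<Rightarrow> form \<Rightarrow> 'k" where
  "lost_term v d (FormC i j1 j2 ks ls) = d (Y i) * monomial_at v (word ks (j1 # j2 # ls))"
| "lost_term v d _ = 0"

definition assign :: "(gvar \<Rightarrow> 'k::field) \<Rightarrow> (gvar \<Rightarrow> 'k) \<Rightarrow> gvar \<Rightarrow> 'k^2^2" where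
  "assign v d X = (case X of Y i \<Rightarrow> tri (v X) (d X) 0 | Z i \<Rightarrow> tri 0 0 (v X))"

lemma assign_simps [simp]:
  "assign v d (Y i) = tri (v (Y i)) (d (Y i)) 0" "assign v d (Z i) = tri 0 0 (v (Z i))"
  by (simp_all add: assign_def)

lemma left_normed_snoc [simp]:
  "left_normed [] = 1" "left_normed (fs @ [f]) = left_normed fs * f"
  by (simp_all add: left_normed_def)

text \<open>Even values multiply like dual numbers with tangent part \<open>d\<close>, so the e12
  coordinate is the derivative of the scalar one; odd variables have no tangent part, whence
  \<open>d (Z i) = 0\<close>. An odd factor applied to \<open>y i\<close> erases its tangent part,
  which gives \<open>lost_term\<close>.\<close>

lemma eval_form:
  fixes v d :: "gvar \<Rightarrow> 'k::field"
  assumes "CHAR('k) \<noteq> 2" and d: "\<And>i. d (Z i) = 0" and t: "admissible t"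
  shows "eval scaleM jordan_prod (mat 1) (assign v d) (form_poly t) =
    (if is_B t then tri 0 0 (monomial_at v (form_word t))
     else tri (monomial_at v (form_word t)) (derivation_at v d (form_word t) - lost_term v d t) 0)"
proof -
  have two: "(2::'k) \<noteq> 0" using assms(1) by (rule two_neq_0)
  interpret M: unital_jordan_algebra "scaleM :: 'k \<Rightarrow> _" jordan_prod "mat 1"
    using assms(1) by (rule jordan_prod_algebra)
  let ?e = "eval scaleM jordan_prod (mat 1) (assign v d)"
  note simps = M.eval_simps(1-5) HOL.trans[OF M.eval_simps(6) tri_linear(3)] M.eval_var
    jordan_prod_tri[OF two]
  have Y: "?e (y_prod ks) =
      tri (monomial_at v (image_mset Y (mset ks))) (derivation_at v d (image_mset Y (mset ks))) 0"
    for ks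
    by (induction ks rule: rev_induct) (simp_all add: simps algebra_simps)
  have Z: "?e (z_prod ls) =
      (if even (length ls) then tri (monomial_at v (image_mset Z (mset ls))) 0 0
       else tri 0 0 (monomial_at v (image_mset Z (mset ls))))" for ls
    by (induction ls rule: rev_induct) (simp_all add: simps algebra_simps)
  have dZ: "derivation_at v d (image_mset Z m) = 0" for m
    by (induction m) (simp_all add: d)
  show ?thesis
    using t by (cases t)
      (simp_all add: simps Y Z word_def derivation_at_union dZ d algebra_simps)
qed

text \<open>The coefficients are eliminated in the order (b), (c), (a), using the e11 - e22, the e12
  and the scalar coordinate.\<close>

lemma forms_independent:
  fixes c :: "form \<Rightarrow> 'k::field"
  assumes inf: "infinite (UNIV :: 'k set)" and char: "CHAR('k) \<noteq> 2"
    and F: "finite F" "F \<subseteq> Collect admissible"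
    and zero: "(\<Sum>t\<in>F. scaleJ (c t) (form_poly t)) \<in> T_Ass"
    and "t0 \<in> F"
  shows "c t0 = 0"
proof -
  interpret M: unital_jordan_algebra "scaleM :: 'k \<Rightarrow> _" jordan_prod "mat 1"
    using char by (rule jordan_prod_algebra)
  have adm: "admissible t" if "t \<in> F" for t using F(2) that by blast
  define cB where "cB t = (if is_B t then c t else 0)" for t
  define cN where "cN t = (if is_B t then 0 else c t)" for t
  have coords: "(\<Sum>t\<in>F. cB t * monomial_at v (form_word t)) = 0"
      "(\<Sum>t\<in>F. cN t * monomial_at v (form_word t)) = 0"
      "(\<Sum>t\<in>F. cN t * (derivation_at v d (form_word t) - lost_term v d t)) = 0"
    if d: "\<And>i. d (Z i) = 0" for v d
  proof -
    let ?e = "eval scaleM jordan_prod (mat 1) (assign v d)"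
    have "\<forall>i. assign v d (Y i) \<in> UJ2_ass 0" "\<forall>i. assign v d (Z i) \<in> UJ2_ass 1"
      by (auto simp: UJ2_ass_0_tri UJ2_ass_1_tri)
    then have "0 = ?e (\<Sum>t\<in>F. scaleJ (c t) (form_poly t))"
      using zero unfolding T_Ass_def by (simp only: mem_Collect_eq simp_thms)
    also have "\<dots> = (\<Sum>t\<in>F. scaleM (c t) (?e (form_poly t)))"
      by (simp only: M.eval_simps)
    also have "\<dots> = (\<Sum>t\<in>F. tri (cN t * monomial_at v (form_word t))
        (cN t * (derivation_at v d (form_word t) - lost_term v d t))
        (cB t * monomial_at v (form_word t)))"
      by (rule sum.cong) (auto simp: eval_form[where d = d, OF char d adm] tri_linear(2) cN_def cB_def)
    also have "\<dots> = tri (\<Sum>t\<in>F. cN t * monomial_at v (form_word t))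
        (\<Sum>t\<in>F. cN t * (derivation_at v d (form_word t) - lost_term v d t))
        (\<Sum>t\<in>F. cB t * monomial_at v (form_word t))"
      by (rule sum_tri)
    finally have tri: "tri (\<Sum>t\<in>F. cN t * monomial_at v (form_word t))
        (\<Sum>t\<in>F. cN t * (derivation_at v d (form_word t) - lost_term v d t))
        (\<Sum>t\<in>F. cB t * monomial_at v (form_word t)) = 0" by (rule HOL.sym)
    show "(\<Sum>t\<in>F. cB t * monomial_at v (form_word t)) = 0"
      "(\<Sum>t\<in>F. cN t * monomial_at v (form_word t)) = 0"
      "(\<Sum>t\<in>F. cN t * (derivation_at v d (form_word t) - lost_term v d t)) = 0"
      by (fact tri_eq_0[OF two_neq_0[OF char] tri])+
  qed
  have B: "c t = 0" if t: "t \<in> F" "is_B t" for t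
  proof -
    have "cB t = 0"
    proof (rule monomial_coefficient_zero[OF inf F(1) coords(1)[of "\<lambda>_. 0"] t(1)])
      fix s assume s: "s \<in> F" "form_word s = form_word t" "s \<noteq> t"
      have False if "is_B s"
        using that s t adm[OF s(1)] adm[OF t(1)]
        by (cases s; cases t) (auto dest!: word_inject)
      then show "cB s = 0" by (auto simp: cB_def)
    qed simp
    then show ?thesis using t by (simp add: cB_def)
  qed
  \<comment> \<open>The scalar relation transfers from monomials to their derivatives, so the full
    derivatives cancel from the e12 relation.\<close>
  have lost: "(\<Sum>t\<in>F. cN t * lost_term v d t) = 0" if d: "\<And>i. d (Z i) = 0" for v d
  proof -
    have "(\<Sum>t\<in>F. cN t * derivation_at v d (form_word t)) = 0"
      by (rule monomial_sum_transfer[OF inf F(1) coords(2)[of "\<lambda>_. 0"]]) simp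
    then show ?thesis
      using coords(3)[of d v, OF d] by (simp add: algebra_simps sum_subtractf)
  qed
  have C: "c t = 0" if t: "t \<in> F" "t = FormC i j1 j2 ks ls" for t i j1 j2 ks ls
  proof -
    \<comment> \<open>The direction that is 1 at \<open>Y i\<close> and 0 elsewhere selects the
      forms (c) with this \<open>i\<close>. Their lost terms are the monomials \<open>rest\<close>;
      the default \<open>{#}\<close> occurs only with coefficient 0.\<close>
    define cC where "cC t = (case t of FormC i' _ _ _ _ \<Rightarrow> if i' = i then c t else 0 | _ \<Rightarrow> 0)" for t
    define rest where "rest t = (case t of FormC _ j1 j2 ks ls \<Rightarrow> word ks (j1 # j2 # ls) | _ \<Rightarrow> {#})"
      for t
    have "cC t = 0"
    proof (rule monomial_coefficient_zero[OF inf F(1) _ t(1)])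
      fix v :: "gvar \<Rightarrow> 'k"
      have "(\<Sum>t\<in>F. cC t * monomial_at v (rest t)) =
          (\<Sum>t\<in>F. cN t * lost_term v (\<lambda>x. if x = Y i then 1 else 0) t)"
        by (rule sum.cong) (auto simp: cC_def rest_def cN_def split: form.splits)
      then show "(\<Sum>t\<in>F. cC t * monomial_at v (rest t)) = 0"
        using lost by simp
    next
      fix s assume s: "s \<in> F" "rest s = rest t" "s \<noteq> t"
      then show "cC s = 0"
        using t adm[OF s(1)] adm[OF t(1)]
        by (cases s) (auto simp: cC_def rest_def dest!: word_inject)
    qed
    then show ?thesis using t by (simp add: cC_def)
  qed
  \<comment> \<open>A form (c) may have the same word as a form (a), but its coefficient is already
    zero.\<close>
  have A: "c t = 0" if t: "t \<in> F" "t = FormA ks ls" for t ks ls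
  proof -
    have "cN t = 0"
    proof (rule monomial_coefficient_zero[OF inf F(1) coords(2)[of "\<lambda>_. 0"] t(1)])
      fix s assume s: "s \<in> F" "form_word s = form_word t" "s \<noteq> t"
      then show "cN s = 0"
        using t C[OF s(1)] adm[OF s(1)] adm[OF t(1)]
        by (cases s) (auto simp: cN_def dest!: word_inject)
    qed simp
    then show ?thesis using t by (simp add: cN_def)
  qed
  show ?thesis
    using assms(6) A B C by (cases t0) auto
qed

section \<open>The identities of the graded algebra\<close>

text \<open>A graded endomorphism followed by a graded evaluation is again a graded evaluation, by
  uniqueness of homomorphisms from the free algebra.\<close>

lemma T_ideal_T_Ass:
  assumes "CHAR('k::field) \<noteq> 2"
  shows "T_ideal (T_Ass :: 'k jpoly set)"
proof -
  interpret M: unital_jordan_algebra "scaleM :: 'k \<Rightarrow> _" jordan_prod "mat 1"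
    using assms by (rule jordan_prod_algebra)
  have unit: "mat 1 \<in> (UJ2_ass 0 :: ('k^2^2) set)"
    by (auto simp: UJ2_ass_0_tri tri_linear(3))
  have sub: "M.subspace (UJ2_ass d :: ('k^2^2) set)" for d
    by (simp add: UJ2_ass_def)
  have graded: "\<phi> ` T_Ass \<subseteq> T_Ass" if \<phi>: "graded_endomorphism \<phi>" for \<phi> :: "'k jpoly \<Rightarrow> 'k jpoly"
  proof
    fix g assume "g \<in> \<phi> ` T_Ass"
    then obtain f where f: "f \<in> T_Ass" "g = \<phi> f" by blast
    show "g \<in> T_Ass"
      unfolding T_Ass_def
    proof (intro CollectI allI impI)
      fix \<rho> :: "gvar \<Rightarrow> 'k^2^2"
      assume \<rho>: "(\<forall>i. \<rho> (Y i) \<in> UJ2_ass 0) \<and> (\<forall>i. \<rho> (Z i) \<in> UJ2_ass 1)"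
      let ?e = "eval scaleM jordan_prod (mat 1) \<rho>"
      have comp: "?e h \<in> UJ2_ass d" if "h \<in> J_component d" for h d
        by (rule M.eval_J_component[of UJ2_ass \<rho>, OF sub unit UJ2_ass_graded _ _ that])
          (use \<rho> in auto)
      have hom: "algebra_hom scaleJ (*) 1 scaleJ (*) 1 \<phi>"
        and d: "\<And>d h. h \<in> J_component d \<Longrightarrow> \<phi> h \<in> J_component d"
        using \<phi> unfolding graded_endomorphism_def by blast+
      have "algebra_hom scaleJ (*) 1 scaleM jordan_prod (mat 1) (?e \<circ> \<phi>)"
        using hom M.eval_hom[of \<rho>]
        by (auto simp: algebra_hom_def intro: Vector_Spaces.linear_compose)
      then have "?e \<circ> \<phi> = eval scaleM jordan_prod (mat 1) (\<lambda>x. ?e (\<phi> (var x)))"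
        by (rule M.eval_unique) simp
      then have "?e (\<phi> f) = eval scaleM jordan_prod (mat 1) (\<lambda>x. ?e (\<phi> (var x))) f"
        by (metis comp_apply)
      also have "\<dots> = 0"
      proof -
        have "\<forall>i. ?e (\<phi> (y i)) \<in> UJ2_ass 0" "\<forall>i. ?e (\<phi> (z i)) \<in> UJ2_ass 1"
          by (intro allI comp d y_J_component z_J_component)+
        then show ?thesis using f(1) unfolding T_Ass_def by simp
      qed
      finally show "?e g = 0" by (simp add: f(2))
    qed
  qed
  show ?thesis
    unfolding T_ideal_def
    using graded by (auto simp: J.subspace_def T_Ass_def M.eval_simps)
qed

lemma I_Ass_subset_T_Ass:
  assumes "CHAR('k::field) \<noteq> 2"
  shows "(I_Ass :: 'k jpoly set) \<subseteq> T_Ass"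
  unfolding I_Ass_def
proof (rule T_ideal_generated_least[OF T_ideal_T_Ass[OF assms]])
  have two: "(2::'k) \<noteq> 0" using assms by (rule two_neq_0)
  interpret M: unital_jordan_algebra "scaleM :: 'k \<Rightarrow> _" jordan_prod "mat 1"
    using assms by (rule jordan_prod_algebra)
  show "{associator (y 1) (y 2) (y 3), associator (z 1) (y 1) (y 2), associator (z 1) (y 1) (z 2),
     associator (z 1) (z 2) (z 3), associator (z 1 * z 2) (z 3) (z 4)} \<subseteq> (T_Ass :: 'k jpoly set)"
  proof -
    have "eval scaleM jordan_prod (mat 1) \<rho> f = 0"
      if \<rho>: "\<forall>i. \<rho> (Y i) \<in> UJ2_ass 0" "\<forall>i. \<rho> (Z i) \<in> UJ2_ass 1"
        and f: "f \<in> {associator (y 1) (y 2) (y 3), associator (z 1) (y 1) (y 2),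
          associator (z 1) (y 1) (z 2), associator (z 1) (z 2) (z 3),
          associator (z 1 * z 2) (z 3) (z 4)}" for \<rho> and f :: "'k jpoly"
    proof -
      obtain a b c where tri: "\<And>i. \<rho> (Y i) = tri (a i) (b i) 0" "\<And>i. \<rho> (Z i) = tri 0 0 (c i)"
        using \<rho> unfolding UJ2_ass_0_tri UJ2_ass_1_tri by metis
      show ?thesis
        using f
        by (elim insertE emptyE; hypsubst)
          (simp_all add: associator_def M.eval_simps M.eval_var tri jordan_prod_tri[OF two]
            algebra_simps)
    qed
    then show ?thesis unfolding T_Ass_def by blast
  qed
qed

text \<open>Injectivity comes along with independence, because \<open>b s = b t\<close> is the
  relation with coefficients 1 and -1.\<close>

lemma (in vector_space) independent_family:
  assumes "\<And>F c t. finite F \<Longrightarrow> F \<subseteq> A \<Longrightarrow> (\<Sum>t\<in>F. scale (c t) (b t)) = 0 \<Longrightarrow> t \<in> F \<Longrightarrow> c t = 0"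
  shows "inj_on b A" "independent (b ` A)"
proof -
  show inj: "inj_on b A"
  proof (rule inj_onI, rule ccontr)
    fix s t assume st: "s \<in> A" "t \<in> A" "b s = b t" "s \<noteq> t"
    then have "(\<Sum>x\<in>{s, t}. scale (if x = s then 1 else - 1) (b x)) = 0" by simp
    then have "(if s = s then 1 else - 1 :: 'a) = 0"
      by (rule assms[rotated 2]) (use st in auto)
    then show False by simp
  qed
  show "independent (b ` A)"
    unfolding independent_explicit_module
  proof (intro allI impI)
    fix T u v assume T: "finite T" "T \<subseteq> b ` A" "(\<Sum>x\<in>T. scale (u x) x) = 0" "v \<in> T"
    then obtain F where F: "F \<subseteq> A" "finite F" "T = b ` F"
      by (meson finite_subset_image)
    then have "(\<Sum>t\<in>F. scale (u (b t)) (b t)) = 0"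
      using T(3) sum.reindex[OF inj_on_subset[OF inj F(1)], of "\<lambda>x. scale (u x) x"]
      by (simp add: comp_def)
    moreover obtain t where "t \<in> F" "v = b t" using F(3) T(4) by blast
    ultimately show "u v = 0"
      using assms[OF F(2,1), of "\<lambda>t. u (b t)" t] by simp
  qed
qed

theorem theorem3p11:
  assumes "infinite (UNIV :: 'k::field set)" and "CHAR('k) \<noteq> 2"
  shows "(I_Ass :: 'k jpoly set) = T_Ass \<and>
    inj_on coset (S_Ass :: 'k jpoly set) \<and>
    Q.independent (coset ` (S_Ass :: 'k jpoly set)) \<and>
    Q.span (coset ` (S_Ass :: 'k jpoly set)) = UNIV"
proof -
  let ?b = "\<lambda>t. coset (form_poly t :: 'k jpoly)"
  have coset_sum: "(\<Sum>t\<in>F. scaleQ (c t) (?b t)) = coset (\<Sum>t\<in>F. scaleJ (c t) (form_poly t))"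
    for F and c :: "form \<Rightarrow> 'k"
    by (simp add: coset.sum coset.scale)
  have ind: "c t = 0"
    if "finite F" "F \<subseteq> Collect admissible" "(\<Sum>t\<in>F. scaleQ (c t) (?b t)) = 0" "t \<in> F"
    for F t and c :: "form \<Rightarrow> 'k"
  proof -
    have "coset (\<Sum>t\<in>F. scaleJ (c t) (form_poly t)) = coset (0 :: 'k jpoly)"
      using that(3) by (simp add: coset_sum coset.zero)
    then have "(\<Sum>t\<in>F. scaleJ (c t) (form_poly t)) \<in> (I_Ass :: 'k jpoly set)"
      by (simp only: coset_eq_iff diff_zero)
    then show ?thesis
      using forms_independent[OF assms that(1,2) _ that(4)] I_Ass_subset_T_Ass[OF assms(2)] by blast
  qed
  have inj: "inj_on ?b (Collect admissible)" and indep: "Q.independent (?b ` Collect admissible)"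
    using Q.independent_family[of "Collect admissible" ?b] ind by blast+
  have S: "coset ` (S_Ass :: 'k jpoly set) = ?b ` Collect admissible"
    by (simp add: S_Ass_forms image_image)
  have span: "Q.span (coset ` (S_Ass :: 'k jpoly set)) = UNIV"
    using assms(2) by (rule span_coset_S_Ass)
  \<comment> \<open>Modulo the ideal an identity \<open>f\<close> is a combination \<open>?g\<close>
    of forms, which is again an identity since \<open>I_Ass\<close> lies in \<open>T_Ass\<close>.
    Independence modulo \<open>T_Ass\<close> makes \<open>?g\<close> zero.\<close>
  have "(T_Ass :: 'k jpoly set) \<subseteq> I_Ass"
  proof
    fix f :: "'k jpoly" assume f: "f \<in> T_Ass"
    have "coset f \<in> Q.span (?b ` Collect admissible)" using span S by simp
    then obtain T u where T: "finite T" "T \<subseteq> ?b ` Collect admissible"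
      "coset f = (\<Sum>a\<in>T. scaleQ (u a) a)"
      unfolding Q.span_explicit by auto
    then obtain F where F: "F \<subseteq> Collect admissible" "finite F" "T = ?b ` F"
      by (meson finite_subset_image)
    let ?g = "\<Sum>t\<in>F. scaleJ (u (?b t)) (form_poly t) :: 'k jpoly"
    have "inj_on ?b F" using inj F(1) by (rule inj_on_subset)
    then have "coset f = coset ?g"
      using T(3) F(3) coset_sum[of "\<lambda>t. u (?b t)" F] by (simp add: sum.reindex)
    then have fg: "f - ?g \<in> I_Ass" by (simp add: coset_eq_iff)
    have "f - (f - ?g) \<in> T_Ass"
      using fg f I_Ass_subset_T_Ass[OF assms(2)] T_ideal_T_Ass[OF assms(2)]
      unfolding T_ideal_def by (blast intro: J.subspace_diff)
    then have "?g \<in> T_Ass" by simp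
    then have "u (?b t) = 0" if "t \<in> F" for t
      using forms_independent[OF assms F(2,1), of "\<lambda>t. u (?b t)"] that by simp
    then have "?g = 0" by simp
    then show "f \<in> I_Ass" using fg by simp
  qed
  moreover have "inj_on coset (S_Ass :: 'k jpoly set)"
    unfolding S_Ass_forms using inj by (intro inj_on_imageI) (simp add: comp_def)
  ultimately show ?thesis
    using I_Ass_subset_T_Ass[OF assms(2)] indep span S by auto
qed

end
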